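(* Let $n\ge3$ and $1\le k\le n-1$, and let $P_1$ be the $N$-shape poset on $[n]$, i.e. the poset whose order is generated by the relations $1\prec2\prec\cdots\prec k$, $\;k+1\prec k+2\prec\cdots\prec n$, and $k+1\prec k$. Then the second-largest eigenvalue of $M_{P_1}$ satisfies $$\lambda_2(P_1)\le\left(1+\frac1n\right)\left(1-\frac2n\right).$$
   Context: Let $P$ be a finite poset of size $n$ with order $\preceq$, whose elements are labeled by $[n]=\{1,\dots,n\}$. A linear extension of $P$ is a permutation $\pi=\pi_1\cdots\pi_n\in S_n$ such that $\pi_i\prec\pi_j$ in $P$ implies $i<j$; $\mathcal L(P)$ is the set of all linear extensions. For $\pi\in\mathcal L(P)$ and $1\le i\le n-1$, let $\pi\cdot\tau_i$ be the linear extension obtained from $\pi$ by interchanging the entries at positions $i$ and $i+1$ if $\pi_i$ and $\pi_{i+1}$ are incomparable in $P$, and $\pi\cdot\tau_i=\pi$ otherwise. Operators act on the right, so in a product the leftmost operator is applied first. For $i,j\in[n]$ set $T_{i,j}=\tau_i\tau_{i+1}\cdots\tau_{j-1}$ if $i\le j$ (the identity if $i=j$) and $T_{i,j}=\tau_{i-1}\tau_{i-2}\cdots\tau_j$ if $i>j$. The $P$-random-to-random shuffle is the Markov chain on $\mathcal L(P)$ with transition matrix $$M_P(\pi,\pi')=\frac1{n^2}\left|\{(i,j)\in[n]\times[n] \mid \pi'=\pi\cdot T_{i,j}\}\right|.$$ The matrix $M_P$ is real symmetric and stochastic with largest eigenvalue $1$; when $P$ is not a chain, $\lambda_2(P)$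 denotes its second-largest eigenvalue (counted with multiplicity). *)

theory Defs
  imports
    "HOL-Combinatorics.Permutations"
    "HOL-Library.Countable_Set"
    "HOL-Computational_Algebra.Fundamental_Theorem_Algebra"
    "Jordan_Normal_Form.Char_Poly"
begin

text \<open>
  A poset on \<open>{1..n}\<close> is given by its reflexive order relation \<open>r\<close>
  (\<^term>\<open>partial_order_on {1..n} r\<close>); \<open>(a, b) \<in> r\<close> means that
  \<open>a\<close> is below or equal to \<open>b\<close>. A word in \<open>S\<^sub>n\<close> is a function
  \<open>\<pi>\<close> permuting \<open>{1..n}\<close>, with \<open>\<pi> i\<close> the entry at position \<open>i\<close>.
\<close>

definition linear_extensions :: "nat \<Rightarrow> nat rel \<Rightarrow> (nat \<Rightarrow> nat) set" where
  "linear_extensions n r =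
     {\<pi>. \<pi> permutes {1..n} \<and>
         (\<forall>i\<in>{1..n}. \<forall>j\<in>{1..n}. (\<pi> i, \<pi> j) \<in> r \<and> \<pi> i \<noteq> \<pi> j \<longrightarrow> i < j)}"

definition incomparable :: "nat rel \<Rightarrow> nat \<Rightarrow> nat \<Rightarrow> bool" where
  "incomparable r a b \<longleftrightarrow> (a, b) \<notin> r \<and> (b, a) \<notin> r"

definition tau :: "nat rel \<Rightarrow> nat \<Rightarrow> (nat \<Rightarrow> nat) \<Rightarrow> (nat \<Rightarrow> nat)" where
  "tau r i \<pi> =
     (if incomparable r (\<pi> i) (\<pi> (i + 1)) then \<pi> \<circ> transpose i (i + 1) else \<pi>)"

text \<open>
  The operators act on the right, so the leftmost factor of a product is applied
  first; this is the order in which \<^const>\<open>fold\<close> runs through the list of indices.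
\<close>

definition T_op :: "nat rel \<Rightarrow> nat \<Rightarrow> nat \<Rightarrow> (nat \<Rightarrow> nat) \<Rightarrow> (nat \<Rightarrow> nat)" where
  "T_op r i j \<pi> =
     (if i \<le> j then fold (tau r) [i..<j] \<pi> else fold (tau r) (rev [j..<i]) \<pi>)"

definition r2r_prob :: "nat \<Rightarrow> nat rel \<Rightarrow> (nat \<Rightarrow> nat) \<Rightarrow> (nat \<Rightarrow> nat) \<Rightarrow> real" where
  "r2r_prob n r \<pi> \<pi>' =
     real (card {(i, j). i \<in> {1..n} \<and> j \<in> {1..n} \<and> \<pi>' = T_op r i j \<pi>}) / (real n)\<^sup>2"

text \<open>
  Matrices are indexed by natural numbers, so the linear extensions are enumerated
  by \<^const>\<open>from_nat_into\<close>, which is a bijection from \<open>{..<card S}\<close> onto a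
  finite set \<open>S\<close>. Another enumeration conjugates the matrix by a permutation matrix,
  which does not change the characteristic polynomial.
\<close>

definition r2r_matrix :: "nat \<Rightarrow> nat rel \<Rightarrow> real mat" where
  "r2r_matrix n r =
     (let L = linear_extensions n r
      in mat (card L) (card L)
           (\<lambda>(a, b). r2r_prob n r (from_nat_into L a) (from_nat_into L b)))"

text \<open>
  \<^const>\<open>proots\<close> is the multiset of roots with multiplicity. For a real symmetric
  matrix all eigenvalues are real, and algebraic and geometric multiplicities agree, so
  for matrices of dimension at least 2 the list below has at least two entries.
  The head of the list is the largest eigenvalue.
\<close>

definition eigenvalues_desc :: "real mat \<Rightarrow> real list" where
  "eigenvalues_desc A = rev (sorted_list_of_multiset (proots (char_poly A)))"

definition lambda2 :: "nat \<Rightarrow> nat rel \<Rightarrow> real" where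
  "lambda2 n r = eigenvalues_desc (r2r_matrix n r) ! 1"

definition N_shape_gens :: "nat \<Rightarrow> nat \<Rightarrow> nat rel" where
  "N_shape_gens n k =
     {(a, a + 1) | a. 1 \<le> a \<and> a < k} \<union> {(a, a + 1) | a. k + 1 \<le> a \<and> a < n} \<union> {(k + 1, k)}"

definition N_shape :: "nat \<Rightarrow> nat \<Rightarrow> nat rel" where
  "N_shape n k = Id_on {1..n} \<union> (N_shape_gens n k)\<^sup>+"

lemma partial_order_on_N_shape:
  assumes "1 \<le> k" "k \<le> n - 1"
  shows "partial_order_on {1..n} (N_shape n k)"
proof -
  have sub: "N_shape_gens n k \<subseteq> {1..n} \<times> {1..n}"
    using assms by (auto simp: N_shape_gens_def)
  have tr: "(N_shape_gens n k)\<^sup>+ \<subseteq> {1..n} \<times> {1..n}"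
    using trancl_subset_Sigma[OF sub] .
  have "N_shape_gens n k \<subseteq> measure (\<lambda>a. if a \<le> k then a + n else a)"
    using assms by (auto simp: N_shape_gens_def)
  then have "wf (N_shape_gens n k)"
    using wf_measure wf_subset by blast
  then have ac: "(a, b) \<in> (N_shape_gens n k)\<^sup>+ \<Longrightarrow> (b, a) \<notin> (N_shape_gens n k)\<^sup>+" for a b
    by (meson trancl_trans wf_acyclic acyclic_def)
  have "trans (N_shape n k)"
    unfolding trans_def N_shape_def by (auto intro: trancl_trans)
  moreover have "antisym (N_shape n k)"
    unfolding antisym_def N_shape_def using ac by auto
  moreover have "N_shape n k \<subseteq> {1..n} \<times> {1..n}" "refl_on {1..n} (N_shape n k)"
    using tr by (auto simp: N_shape_def refl_on_def)
  ultimately show ?thesis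
    by (simp add: partial_order_on_def preorder_on_def)
qed

lemma N_shape_not_chain:
  assumes "3 \<le> n" "1 \<le> k" "k \<le> n - 1"
  shows "\<not> total_on {1..n} (N_shape n k)"
proof -
  have up: "(x, y) \<in> (N_shape_gens n k)\<^sup>+ \<Longrightarrow> x \<le> k \<Longrightarrow> x < y \<and> y \<le> k" for x y
    by (induction rule: trancl_induct) (use assms in \<open>auto simp: N_shape_gens_def\<close>)
  have nk: "(x, y) \<in> (N_shape_gens n k)\<^sup>+ \<Longrightarrow> x = n \<Longrightarrow> k + 1 < n \<Longrightarrow> False" for x y
    by (induction rule: trancl_induct) (use assms in \<open>auto simp: N_shape_gens_def\<close>)
  have n1: "(x, y) \<in> (N_shape_gens n k)\<^sup>+ \<Longrightarrow> x = k + 1 \<Longrightarrow> n = k + 1 \<Longrightarrow> k \<le> y" for x y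
    by (induction rule: trancl_induct) (use assms in \<open>auto simp: N_shape_gens_def\<close>)
  have "(1, n) \<notin> N_shape n k"
    using up[of 1 n] assms by (auto simp: N_shape_def)
  moreover have "(n, 1) \<notin> N_shape n k"
  proof (cases "n = k + 1")
    case True
    then show ?thesis using n1[of n 1] assms by (auto simp: N_shape_def)
  next
    case False
    then have "k + 1 < n" using assms by linarith
    then show ?thesis using nk[of n 1] assms by (auto simp: N_shape_def)
  qed
  moreover have "1 \<in> {1..n}" "n \<in> {1..n}" "1 \<noteq> n"
    using assms by auto
  ultimately show ?thesis
    unfolding total_on_def by blast
qed

end

theory Submission
  imports Defs "HOL-Analysis.Function_Topology"
begin

text \<open>
  Write \<open>l = n - k\<close>. A linear extension of the \<open>N\<close>-shape poset is determined by recording, position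
  by position, which of the two chains the entry belongs to. This gives a word with \<open>k\<close> letters
  \<open>False\<close> and \<open>l\<close> letters \<open>True\<close>, and the relation \<open>k + 1 \<prec> k\<close> excludes exactly one word, the sorted
  one \<open>w\<^sub>0 = False\<^sup>k True\<^sup>l\<close>. On words, \<open>\<tau>\<^sub>i\<close> swaps two adjacent letters unless the result would be
  \<open>w\<^sub>0\<close>. The proof compares this restricted shuffle with the random-to-random shuffle of \<^emph>\<open>all\<close> such words, whose
  second eigenvalue is at most \<open>(n + 1) (n - 2) / n\<^sup>2 = (1 + 1/n) (1 - 2/n)\<close>.

  \<^bold>\<open>All words.\<close> Times \<open>n\<^sup>2\<close>, the shuffle of all words is \<open>M = \<Sum>\<^sub>x I\<^sub>x D\<^sub>x\<close>, where \<open>D\<^sub>x\<close> deletes and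
  \<open>I\<^sub>x\<close> inserts a letter \<open>x\<close> in all possible ways. Replacing one \<open>True\<close> by \<open>False\<close> commutes with \<open>M\<close>.
  Applied repeatedly to an eigenvector with coordinate sum zero, it leads to an eigenvector \<open>v\<close> of the
  same eigenvalue that it kills, and \<open>v\<close> still contains a letter \<open>True\<close>. For such a \<open>v\<close>, the
  commutation relations (\<open>del_shuffle_op\<close>) show that deleting \<open>True\<close>, or deleting \<open>False\<close> if the former
  gives zero, leads to an eigenvector of the same kind on words of length \<open>n - 1\<close> with an explicitly
  shifted eigenvalue, unless the result vanishes too. The bound follows by induction on \<open>n\<close> (\<open>highest_weight_eigenvalue_bound\<close>, \<open>shuffle_op_eigenvalue_bound\<close>). Since a symmetric operator
  attains the maximum of its quadratic form at an eigenvector (\<open>rayleigh_maximizer\<close>), the bound holds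
  for the quadratic form of \<open>M\<close> on functions with sum zero (\<open>two_chain_rayleigh_bound\<close>).

  \<^bold>\<open>Comparison.\<close> The two shuffles differ only along the moves from or into \<open>w\<^sub>0\<close>. Let \<open>x\<^sub>i\<close> (\<open>i \<le> k\<close>) be
  the word obtained from \<open>w\<^sub>0\<close> by moving a \<open>True\<close> to position \<open>i\<close>, and \<open>y\<^sub>j\<close> (\<open>j > k\<close>) the one obtained
  by moving a \<open>False\<close> to position \<open>j\<close>. Where the shuffle of all words would move \<open>x\<^sub>i\<close> or \<open>y\<^sub>j\<close> to
  \<open>w\<^sub>0\<close>, the restricted one exchanges \<open>x\<^sub>i\<close> and \<open>y\<^sub>j\<close> (\<open>run_avoid\<close>). Extend a function \<open>f\<close> on
  the words other than \<open>w\<^sub>0\<close> by the value \<open>c\<close> at \<open>w\<^sub>0\<close>. The Dirichlet form of the full shuffle then exceeds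
  that of the restricted one by a multiple of
  \<open>\<Sum>\<^sub>i (f(x\<^sub>i) - c) * \<Sum>\<^sub>j (f(y\<^sub>j) - c)\<close>, which vanishes when \<open>c\<close> is the mean of the \<open>f(x\<^sub>i)\<close>
  (\<open>comparison_identity\<close>). As the extension has at least the variance of \<open>f\<close>, the spectral gap
  does not decrease under the restriction (\<open>avoiding_eigenvalue_bound\<close>).

  \<^bold>\<open>From eigenvectors to the list of roots.\<close> The second entry of the list of roots is controlled by
  splitting the factor \<open>X - 1\<close> off the characteristic polynomial; the cofactor belongs to the action
  on functions modulo constants, and all its real roots have eigenvectors with sum zero
  (\<open>second_eigenvalue_le\<close>).
\<close>

section \<open>Deleting, inserting and replacing letters\<close>

text \<open>
  A function \<open>v\<close> on words stands for the formal sum of the words \<open>w\<close> with coefficients \<open>v w\<close>. The next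
  three operators give the coefficients after deleting one \<open>b\<close>, after inserting one \<open>a\<close>, and after
  replacing one \<open>b\<close> by \<open>a\<close>, each time summed over all places where this can be done. The recursion
  runs over the word at which the new coefficient is read off, which makes the commutation relations
  below provable by structural induction.
\<close>

fun del_letter :: "'a \<Rightarrow> ('a list \<Rightarrow> real) \<Rightarrow> 'a list \<Rightarrow> real" where
  "del_letter b v [] = v [b]"
| "del_letter b v (x # u) = v (b # x # u) + del_letter b (\<lambda>w. v (x # w)) u"

fun ins_letter :: "'a \<Rightarrow> ('a list \<Rightarrow> real) \<Rightarrow> 'a list \<Rightarrow> real" where
  "ins_letter a v [] = 0"
| "ins_letter a v (x # u) = (if x = a then v u else 0) + ins_letter a (\<lambda>w. v (x # w)) u"

fun repl_letter :: "'a \<Rightarrow> 'a \<Rightarrow> ('a list \<Rightarrow> real) \<Rightarrow> 'a list \<Rightarrow> real" where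
  "repl_letter a b v [] = 0"
| "repl_letter a b v (x # u) = (if x = a then v (b # u) else 0) + repl_letter a b (\<lambda>w. v (x # w)) u"

lemma del_letter_add: "del_letter b (\<lambda>w. f w + g w) u = del_letter b f u + del_letter b g u"
  by (induction u arbitrary: f g) auto

lemma del_letter_scale: "del_letter b (\<lambda>w. c * f w) u = c * del_letter b f u"
  by (induction u arbitrary: f) (auto simp: algebra_simps)

lemma del_letter_zero [simp]: "del_letter b (\<lambda>w. 0) u = 0"
  by (induction u) auto

lemma ins_letter_add: "ins_letter b (\<lambda>w. f w + g w) u = ins_letter b f u + ins_letter b g u"
  by (induction u arbitrary: f g) (auto)

lemma ins_letter_zero [simp]: "ins_letter b (\<lambda>w. 0) u = 0"
  by (induction u) auto

lemma repl_letter_add: "repl_letter a b (\<lambda>w. f w + g w) u = repl_letter a b f u + repl_letter a b g u"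
  by (induction u arbitrary: f g) (auto)

lemma repl_letter_scale: "repl_letter a b (\<lambda>w. c * f w) u = c * repl_letter a b f u"
  by (induction u arbitrary: f) (auto simp: algebra_simps)

lemma repl_letter_zero [simp]: "repl_letter a b (\<lambda>w. 0) u = 0"
  by (induction u) auto

lemma if_zero_add: "(\<lambda>w. (if P then f w else 0) + g w) = (if P then (\<lambda>w. f w + g w) else (g :: _ \<Rightarrow> real))"
  by auto

lemma del_letter_commute: "del_letter b (del_letter a v) u = del_letter a (del_letter b v) u"
  by (induction u arbitrary: v) (auto simp: del_letter_add)

text \<open>
  Inserting and then deleting commute except in two situations: the inserted letter itself is deleted,
  which can happen in \<open>length u + 1\<close> places, or the deleted letter stands next to the inserted one. In
  the latter case the order deletion--insertion sees one gap where insertion--deletion sees two, and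
  the surplus is a replacement in place.
\<close>

lemma del_ins_letter:
  "del_letter b (ins_letter a v) u =
     ins_letter a (del_letter b v) u + (if a = b then real (length u + 1) * v u else 0)
       + repl_letter a b v u"
  by (induction u arbitrary: v)
     (auto simp: if_zero_add del_letter_add ins_letter_add algebra_simps)

text \<open>In this relation and the next, the extra term arises when both operators act at the same place.\<close>

lemma del_repl_letter:
  "del_letter c (repl_letter a b v) u =
     repl_letter a b (del_letter c v) u + (if c = a then del_letter b v u else 0)"
  by (induction u arbitrary: v)
     (auto simp: if_zero_add del_letter_add repl_letter_add algebra_simps)

lemma repl_ins_letter:
  "repl_letter a b (ins_letter c v) u =
     ins_letter c (repl_letter a b v) u + (if b = c then ins_letter a v u else 0)"
  by (induction u arbitrary: v)
     (auto simp: if_zero_add ins_letter_add repl_letter_add algebra_simps)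

lemma repl_letter_same: "repl_letter a a v u = real (count_list u a) * v u"
  by (induction u arbitrary: v) (auto simp: algebra_simps)

lemma del_letter_nonzeroE:
  assumes "del_letter a v u \<noteq> 0"
  obtains w where "v w \<noteq> 0" "mset w = add_mset a (mset u)"
  using assms
proof (induction u arbitrary: v thesis)
  case (Cons x u)
  show ?case
  proof (cases "v (a # x # u) = 0")
    case True
    with Cons.prems(2) have "del_letter a (\<lambda>w. v (x # w)) u \<noteq> 0" by simp
    from Cons.IH[OF _ this] Cons.prems(1) show ?thesis
      by (metis add_mset_commute mset.simps(2))
  qed (use Cons.prems in auto)
qed auto

lemma repl_letter_nonzeroE:
  assumes "repl_letter a b v u \<noteq> 0"
  obtains w where "v w \<noteq> 0" "add_mset a (mset w) = add_mset b (mset u)"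
  using assms
proof (induction u arbitrary: v thesis)
  case (Cons x u)
  show ?case
  proof (cases "x = a \<and> v (b # u) \<noteq> 0")
    case False
    with Cons.prems(2) have "repl_letter a b (\<lambda>w. v (x # w)) u \<noteq> 0" by (auto split: if_splits)
    from Cons.IH[OF _ this] Cons.prems(1) show ?thesis
      by (metis add_mset_commute mset.simps(2))
  qed (use Cons.prems in auto)
qed auto

text \<open>
  \<open>n\<^sup>2\<close> times the random-to-random shuffle on words of length \<open>n\<close> over two letters: take a letter out and
  put it back anywhere.
\<close>

definition shuffle_op :: "(bool list \<Rightarrow> real) \<Rightarrow> bool list \<Rightarrow> real" where
  "shuffle_op v w = ins_letter False (del_letter False v) w + ins_letter True (del_letter True v) w"

text \<open>The corrections from passing the insertion and from passing the deletion cancel.\<close>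

lemma repl_shuffle_op: "repl_letter a b (shuffle_op v) u = shuffle_op (repl_letter a b v) u"
proof -
  have 1: "del_letter c (repl_letter a b v) =
      (if c = a then (\<lambda>w. repl_letter a b (del_letter c v) w + del_letter b v w)
       else repl_letter a b (del_letter c v))" for c
    by (auto simp: del_repl_letter)
  show ?thesis
    unfolding shuffle_op_def 1
    by (cases a; cases b) (auto simp: repl_letter_add repl_ins_letter ins_letter_add)
qed

lemma del_shuffle_op:
  "del_letter c (shuffle_op v) u =
     shuffle_op (del_letter c v) u + real (length u + 1) * del_letter c v u
       + repl_letter False c (del_letter False v) u + repl_letter True c (del_letter True v) u"
proof -
  have 1: "del_letter True (del_letter False v) = del_letter False (del_letter True v)"
    by (rule ext) (rule del_letter_commute)
  show ?thesis
    unfolding shuffle_op_def by (cases c) (simp_all add: del_letter_add del_ins_letter 1)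
qed

definition binary_words :: "nat \<Rightarrow> nat \<Rightarrow> bool list set" where
  "binary_words k l = {w. mset w = replicate_mset k False + replicate_mset l True}"

lemma length_binary_words:
  assumes "w \<in> binary_words k l"
  shows "length w = k + l"
proof -
  have "size (mset w) = size (replicate_mset k False + replicate_mset l True)"
    using assms by (simp only: binary_words_def mem_Collect_eq)
  then show ?thesis by simp
qed

definition supported :: "nat \<Rightarrow> nat \<Rightarrow> (bool list \<Rightarrow> real) \<Rightarrow> bool" where
  "supported k l v \<longleftrightarrow> (\<forall>w. v w \<noteq> 0 \<longrightarrow> w \<in> binary_words k l)"

lemma supported_length: "supported k l v \<Longrightarrow> v w \<noteq> 0 \<Longrightarrow> length w = k + l"
  by (simp add: supported_def length_binary_words)

lemma supported_count: "supported k l v \<Longrightarrow> v w \<noteq> 0 \<Longrightarrow>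
    count_list w False = k \<and> count_list w True = l"
  unfolding supported_def binary_words_def by (simp flip: count_mset)

lemma bool_content_eqI:
  "count M False = k \<Longrightarrow> count M True = l \<Longrightarrow> M = replicate_mset k False + replicate_mset l True"
  by (rule multiset_eqI) (metis (full_types) count_replicate_mset count_union add.commute add_0)

lemma supported_del_False:
  assumes "supported k l v" "del_letter False v u \<noteq> 0"
  shows "k \<ge> 1 \<and> mset u = replicate_mset (k - 1) False + replicate_mset l True"
proof -
  obtain w where "v w \<noteq> 0" and w: "mset w = add_mset False (mset u)"
    using assms(2) by (rule del_letter_nonzeroE)
  with assms(1) have "add_mset False (mset u) = replicate_mset k False + replicate_mset l True"
    by (simp add: supported_def binary_words_def)
  then have "count (add_mset False (mset u)) c = count (replicate_mset k False + replicate_mset l True) c" for c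
    by simp
  from this[of False] this[of True] show ?thesis
    by (auto intro!: bool_content_eqI)
qed

lemma supported_del_True:
  assumes "supported k l v" "del_letter True v u \<noteq> 0"
  shows "l \<ge> 1 \<and> mset u = replicate_mset k False + replicate_mset (l - 1) True"
proof -
  obtain w where "v w \<noteq> 0" and w: "mset w = add_mset True (mset u)"
    using assms(2) by (rule del_letter_nonzeroE)
  with assms(1) have "add_mset True (mset u) = replicate_mset k False + replicate_mset l True"
    by (simp add: supported_def binary_words_def)
  then have "count (add_mset True (mset u)) c = count (replicate_mset k False + replicate_mset l True) c" for c
    by simp
  from this[of False] this[of True] show ?thesis
    by (auto intro!: bool_content_eqI)
qed

lemma supported_repl:
  assumes "supported k (Suc l) v"
  shows "supported (Suc k) l (repl_letter False True v)"
  unfolding supported_def binary_words_def mem_Collect_eq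
proof (intro allI impI)
  fix u assume "repl_letter False True v u \<noteq> 0"
  then obtain w where "v w \<noteq> 0" and w: "add_mset False (mset w) = add_mset True (mset u)"
    by (rule repl_letter_nonzeroE)
  with assms have "add_mset False (replicate_mset k False + replicate_mset (Suc l) True) = add_mset True (mset u)"
    by (simp add: supported_def binary_words_def)
  then show "mset u = replicate_mset (Suc k) False + replicate_mset l True"
    by simp
qed

text \<open>
  Both sides sum \<open>v\<close> over the words with one \<open>b\<close> and \<open>m\<close> letters \<open>a\<close>. Hence a \<open>v\<close> of this content that
  is killed by the replacement is also killed by deleting \<open>b\<close>.
\<close>

lemma repl_del_single:
  "repl_letter a b v (replicate (Suc m) a) = del_letter b v (replicate m a)"
  by (induction m arbitrary: v) auto

text \<open>
  Replacing one \<open>True\<close> by \<open>False\<close> is the raising operator of the action of \<open>gl\<^sub>2\<close> on tensors, so \<open>v\<close> is a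
  highest weight vector. Deleting a letter keeps it one and shifts the eigenvalue by \<open>n + l - 2\<close> (when
  deleting \<open>True\<close>), or by \<open>n + k - 1\<close> (when deleting \<open>False\<close>, provided that deleting \<open>True\<close> gives
  zero), where \<open>n = k + l\<close>. The bound \<open>n\<^sup>2 - n - 2\<close> grows by \<open>2 n - 2\<close> from \<open>n - 1\<close> to \<open>n\<close>, so it
  absorbs both shifts. If both deletions give zero, the eigenvalue is 0. The induction cannot run into \<open>l = 0\<close>, where the eigenvalue would be \<open>n\<^sup>2\<close>: if
  \<open>l = 1\<close>, then deleting \<open>True\<close> gives zero.
\<close>

lemma highest_weight_eigenvalue_bound:
  assumes "supported k l v" "l \<ge> 1" "\<And>w. repl_letter False True v w = 0"
    and "\<And>w. shuffle_op v w = \<mu> * v w" "v w0 \<noteq> 0"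
  shows "\<mu> \<le> (real (k + l) + 1) * (real (k + l) - 2)"
  using assms
proof (induction "k + l" arbitrary: k l v \<mu> w0 rule: less_induct)
  case less
  note sup = less.prems(1) and hw = less.prems(3) and eig = less.prems(4)
  have hw': "repl_letter False True v = (\<lambda>_. 0)" and eig': "shuffle_op v = (\<lambda>w. \<mu> * v w)"
    using hw eig by auto
  have replF: "repl_letter False True (del_letter False v) u = - del_letter True v u" for u
    using del_repl_letter[of False False True v u] by (simp add: hw')
  have replT: "repl_letter False True (del_letter True v) u = 0" for u
    using del_repl_letter[of True False True v u] by (simp add: hw')
  consider (T) u where "del_letter True v u \<noteq> 0"
    | (F) u where "\<And>u. del_letter True v u = 0" "del_letter False v u \<noteq> 0"
    | (Z) "\<And>u. del_letter True v u = 0" "\<And>u. del_letter False v u = 0" by blast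
  then show ?case
  proof cases
    case (T u)
    have sup': "supported k (l - 1) (del_letter True v)"
      using supported_del_True[OF sup] by (auto simp: supported_def binary_words_def)
    \<comment> \<open>\<open>l = 1\<close> would leave only the word without \<open>True\<close>, where \<open>repl_del_single\<close> applies\<close>
    have l2: "l \<ge> 2"
    proof (rule ccontr)
      assume "\<not> l \<ge> 2"
      with less.prems(2) have "l = 1" by simp
      then have "mset u = replicate_mset k False" using supported_del_True[OF sup T] by simp
      then have "u = replicate k False"
        by (metis in_replicate_mset replicate_eqI set_mset_mset size_mset size_replicate_mset)
      then show False
        using T repl_del_single[of False True v k] hw[of "replicate (Suc k) False"] by metis
    qed
    have "shuffle_op (del_letter True v) u' = (\<mu> - real (k + l) - real l + 2) * del_letter True v u'" for u'
    proof (cases "del_letter True v u' = 0")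
      case True
      then show ?thesis
        using del_shuffle_op[of True v u'] replF[of u']
        by (simp add: eig' del_letter_scale repl_letter_same)
    next
      case False
      then have "length u' = k + (l - 1)" "count_list u' True = l - 1"
        using supported_length[OF sup'] supported_count[OF sup'] by auto
      then show ?thesis
        using del_shuffle_op[of True v u'] replF[of u'] l2
        by (simp add: eig' del_letter_scale repl_letter_same algebra_simps of_nat_diff)
    qed
    from less.hyps[OF _ sup' _ replT this T] l2
    have "\<mu> - real (k + l) - real l + 2 \<le> (real (k + (l - 1)) + 1) * (real (k + (l - 1)) - 2)"
      by simp
    then show ?thesis using l2 by (simp add: of_nat_diff algebra_simps)
  next
    case (F u)
    have zT: "del_letter True v = (\<lambda>_. 0)" using F by auto
    have k1: "k \<ge> 1" using supported_del_False[OF sup F(2)] by simp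
    have sup': "supported (k - 1) l (del_letter False v)"
      using supported_del_False[OF sup] by (auto simp: supported_def binary_words_def)
    have "shuffle_op (del_letter False v) u' = (\<mu> - real (k + l) - real k + 1) * del_letter False v u'" for u'
    proof (cases "del_letter False v u' = 0")
      case True
      then show ?thesis
        using del_shuffle_op[of False v u']
        by (simp add: eig' del_letter_scale repl_letter_same zT)
    next
      case False
      then have "length u' = k - 1 + l" "count_list u' False = k - 1"
        using supported_length[OF sup'] supported_count[OF sup'] by auto
      then show ?thesis
        using del_shuffle_op[of False v u'] k1
        by (simp add: eig' del_letter_scale repl_letter_same zT algebra_simps of_nat_diff)
    qed
    from less.hyps[OF _ sup' less.prems(2) _ this F(2)] k1 replF F(1)
    have "\<mu> - real (k + l) - real k + 1 \<le> (real (k - 1 + l) + 1) * (real (k - 1 + l) - 2)"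
      by simp
    then show ?thesis using k1 less.prems(2) by (simp add: of_nat_diff algebra_simps)
  next
    case Z
    then have "shuffle_op v w0 = 0"
      by (simp add: shuffle_op_def ext[of "del_letter True v" "\<lambda>_. 0"] ext[of "del_letter False v" "\<lambda>_. 0"])
    then have "\<mu> = 0" using eig[of w0] less.prems(5) by simp
    moreover have "k + l \<ge> 2"
    proof (rule ccontr)
      assume "\<not> k + l \<ge> 2"
      then have "k = 0" "l = 1" using less.prems(2) by auto
      then have "w0 = [True]" using sup less.prems(5) by (auto simp: supported_def binary_words_def)
      then show False using hw[of "[False]"] less.prems(5) by simp
    qed
    ultimately show ?thesis by simp
  qed
qed

definition word_sum :: "nat \<Rightarrow> (bool list \<Rightarrow> real) \<Rightarrow> real" where
  "word_sum n v = (\<Sum>w | length w = n. v w)"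

lemma word_sum_0 [simp]: "word_sum 0 v = v []"
  by (simp add: word_sum_def)

lemma words_Suc: "{w :: bool list. length w = Suc n} = (#) False ` {w. length w = n} \<union> (#) True ` {w. length w = n}"
  by (auto simp: length_Suc_conv)

lemma finite_words [simp]: "finite {w :: bool list. length w = n}"
  using finite_lists_length_eq[of "UNIV :: bool set" n] by simp

lemma word_sum_Suc [simp]: "word_sum (Suc n) v = word_sum n (\<lambda>w. v (False # w)) + word_sum n (\<lambda>w. v (True # w))"
  unfolding word_sum_def words_Suc
  by (subst sum.union_disjoint) (auto simp: sum.reindex)

lemma word_sum_add: "word_sum n (\<lambda>w. f w + g w) = word_sum n f + word_sum n g"
  by (simp add: word_sum_def sum.distrib)

text \<open>
  A word with \<open>m\<close> letters \<open>b\<close> contributes to \<open>m\<close> words; so the replacement preserves sum zero on words of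
  fixed content.
\<close>

lemma word_sum_repl: "word_sum n (repl_letter a b v) = word_sum n (\<lambda>w. real (count_list w b) * v w)"
proof (induction n arbitrary: v)
  case (Suc n)
  then show ?case
    by (cases a; cases b) (simp_all add: if_zero_add word_sum_add distrib_right)
qed simp

text \<open>
  Apply the replacement until the next application would give zero. It commutes with the shuffle, so
  the eigenvalue does not change, and the coordinate sum stays zero. Therefore this stops while a
  letter \<open>True\<close> is left: on the single word without \<open>True\<close>, sum zero would force the vector to vanish.
\<close>

lemma shuffle_op_eigenvalue_bound:
  assumes "supported k l v" "word_sum (k + l) v = 0"
    and "\<And>w. shuffle_op v w = \<mu> * v w" "v w0 \<noteq> 0"
  shows "\<mu> \<le> (real (k + l) + 1) * (real (k + l) - 2)"
  using assms
proof (induction l arbitrary: k v w0)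
  case 0
  have uniq: "w = replicate k False" if "v w \<noteq> 0" for w
  proof -
    have w: "mset w = replicate_mset k False"
      using that 0(1) by (simp add: supported_def binary_words_def)
    have "set w \<subseteq> {False}"
      using arg_cong[OF w, of set_mset] by (auto split: if_splits)
    moreover have "length w = k"
      using arg_cong[OF w, of size] by simp
    ultimately show ?thesis
      by (intro replicate_eqI) auto
  qed
  have "word_sum k v = (\<Sum>w\<in>{replicate k False}. v w)"
    unfolding word_sum_def by (rule sum.mono_neutral_right) (use uniq in auto)
  then show ?case using 0(2,4) uniq by auto
next
  case (Suc l)
  show ?case
  proof (cases "\<forall>w. repl_letter False True v w = 0")
    case True
    then show ?thesis using highest_weight_eigenvalue_bound Suc.prems by (metis le_add1 plus_1_eq_Suc)
  next
    case False
    then obtain w1 where w1: "repl_letter False True v w1 \<noteq> 0" by blast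
    have "shuffle_op (repl_letter False True v) w = \<mu> * repl_letter False True v w" for w
      using repl_shuffle_op[of False True v w] ext[of "shuffle_op v" "\<lambda>w. \<mu> * v w"] Suc.prems(3)
      by (simp add: repl_letter_scale)
    moreover have "word_sum (Suc k + l) (repl_letter False True v) = 0"
    proof -
      have "(\<lambda>w. real (count_list w True) * v w) = (\<lambda>w. real (Suc l) * v w)"
        using supported_count[OF Suc.prems(1)] by (metis mult_cancel_left mult_zero_right)
      then have "word_sum (Suc k + l) (repl_letter False True v) = real (Suc l) * word_sum (Suc k + l) v"
        unfolding word_sum_repl by (simp only: word_sum_def sum_distrib_left)
      then show ?thesis using Suc.prems(2) by simp
    qed
    ultimately show ?thesis
      using Suc.IH[OF supported_repl[OF Suc.prems(1)] _ _ w1] by simp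
  qed
qed

section \<open>Maximising a quadratic form\<close>

lemma linear_coefficient_zero:
  fixes a b :: real
  assumes "\<And>t. a * t + b * t\<^sup>2 \<le> 0"
  shows "a = 0"
proof (rule ccontr)
  assume "a \<noteq> 0"
  define t where "t = a / (\<bar>b\<bar> + 1)"
  have "\<bar>b\<bar> * t\<^sup>2 < (\<bar>b\<bar> + 1) * t\<^sup>2"
    using \<open>a \<noteq> 0\<close> by (intro mult_strict_right_mono) (auto simp: t_def)
  also have "(\<bar>b\<bar> + 1) * t\<^sup>2 = a * t"
    by (simp add: t_def power2_eq_square)
  finally have "a * t + b * t\<^sup>2 > 0"
    using abs_ge_minus_self[of b] mult_right_mono[of "-b" "\<bar>b\<bar>" "t\<^sup>2"] by auto
  with assms[of t] show False by simp
qed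

text \<open>
  The quadratic form attains its maximum on the compact set of functions of norm 1 and sum 0 at some
  \<open>f\<close>. Perturbing \<open>f\<close> in the direction \<open>g = A f - \<mu> f\<close>, which is admissible because constant row sums and
  symmetry make \<open>A\<close> preserve sum 0, changes the form minus \<open>\<mu>\<close> times the square norm at the rate
  \<open>2 \<parallel>g\<parallel>\<^sup>2\<close>; so \<open>g = 0\<close>.
\<close>

lemma rayleigh_maximizer:
  fixes A :: "'a \<Rightarrow> 'a \<Rightarrow> real"
  assumes fin: "finite S" and card: "card S \<ge> 2"
    and sym: "\<And>x y. x \<in> S \<Longrightarrow> y \<in> S \<Longrightarrow> A x y = A y x"
    and rows: "\<And>x. x \<in> S \<Longrightarrow> (\<Sum>y\<in>S. A x y) = R"
  obtains f \<mu> where "\<And>x. x \<in> S \<Longrightarrow> (\<Sum>y\<in>S. A x y * f y) = \<mu> * f x"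
    "(\<Sum>x\<in>S. f x) = 0" "\<exists>x\<in>S. f x \<noteq> 0"
    "\<And>h. (\<Sum>x\<in>S. h x) = 0 \<Longrightarrow> (\<Sum>x\<in>S. h x * (\<Sum>y\<in>S. A x y * h y)) \<le> \<mu> * (\<Sum>x\<in>S. (h x)\<^sup>2)"
proof -
  define q where "q h = (\<Sum>x\<in>S. h x * (\<Sum>y\<in>S. A x y * h y))" for h
  define nn where "nn h = (\<Sum>x\<in>S. (h x)\<^sup>2)" for h :: "'a \<Rightarrow> real"
  \<comment> \<open>fixing the value 0 outside \<open>S\<close> makes the set of candidates compact in the product topology\<close>
  define box where "box = (PiE UNIV (\<lambda>x. if x \<in> S then {-1..1} else {0}) :: ('a \<Rightarrow> real) set)"
  define K where "K = box \<inter> ({f. (\<Sum>x\<in>S. f x) = 0} \<inter> {f. nn f = 1})"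
  have coord: "continuous_on UNIV (\<lambda>f :: 'a \<Rightarrow> real. f x)" for x
    by (rule continuous_on_product_coordinates)
  have cq: "continuous_on UNIV q" and cn: "continuous_on UNIV nn"
    unfolding q_def nn_def by (intro continuous_intros coord)+
  have "compactin (product_topology (\<lambda>_. euclidean) UNIV) box"
    unfolding box_def compactin_PiE by auto
  then have cbox: "compact box"
    by (simp add: euclidean_product_topology)
  have "closed {f :: 'a \<Rightarrow> real. (\<Sum>x\<in>S. f x) = 0}" "closed {f. nn f = 1}"
    by (intro closed_Collect_eq continuous_intros coord cn)+
  then have cK: "compact K"
    unfolding K_def by (intro compact_Int_closed cbox closed_Int)
  obtain s t where st: "s \<in> S" "t \<in> S" "s \<noteq> t"
    using card card_le_Suc0_iff_eq[OF fin] by force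
  have normalise: "\<exists>g\<in>K. q h = nn h * q g" if h0: "(\<Sum>x\<in>S. h x) = 0" and hn: "nn h > 0" for h
  proof -
    define g where "g x = (if x \<in> S then h x / sqrt (nn h) else 0)" for x
    have "nn g = (\<Sum>x\<in>S. (h x)\<^sup>2 / nn h)"
      unfolding nn_def[of g] using hn by (intro sum.cong refl) (simp add: g_def power_divide)
    also have "\<dots> = nn h / nn h"
      by (simp only: nn_def sum_divide_distrib)
    finally have nng: "nn g = 1" using hn by simp
    have "g x \<in> {-1..1}" if "x \<in> S" for x
    proof -
      have "(g x)\<^sup>2 \<le> nn g"
        unfolding nn_def using that fin by (intro member_le_sum) auto
      then show ?thesis using nng by (simp add: abs_square_le_1 abs_le_iff)
    qed
    then have "g x \<in> (if x \<in> S then {-1..1} else {0})" for x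
      by (cases "x \<in> S") (simp_all add: g_def)
    then have "g \<in> box"
      unfolding box_def by blast
    moreover have "(\<Sum>x\<in>S. g x) = 0"
    proof -
      have "(\<Sum>x\<in>S. g x) = (\<Sum>x\<in>S. h x / sqrt (nn h))"
        by (intro sum.cong refl) (simp add: g_def)
      then show ?thesis
        using h0 by (simp flip: sum_divide_distrib)
    qed
    ultimately have "g \<in> K"
      using nng by (simp add: K_def)
    moreover have "q h = nn h * q g"
    proof -
      have hg: "h x = sqrt (nn h) * g x" if "x \<in> S" for x
        using that hn by (simp add: g_def)
      define c where "c = sqrt (nn h)"
      have "q h = (\<Sum>x\<in>S. (c * g x) * (\<Sum>y\<in>S. A x y * (c * g y)))"
        unfolding q_def c_def by (intro sum.cong refl arg_cong2[of _ _ _ _ "(*)"]) (auto simp: hg)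
      also have "\<dots> = (c * c) * q g"
        unfolding q_def sum_distrib_left by (intro sum.cong refl) (simp add: algebra_simps)
      finally show ?thesis using hn by (simp add: c_def)
    qed
    ultimately show ?thesis by blast
  qed
  have "K \<noteq> {}"
  proof -
    define h where "h x = (if x = s then 1 else if x = t then -1 else 0 :: real)" for x
    have "h = (\<lambda>x. (if s = x then 1 else 0) + (if t = x then -1 else 0))"
      using st by (auto simp: h_def)
    then have "(\<Sum>x\<in>S. h x) = 0"
      using st fin by (simp add: sum.distrib)
    moreover have "(h s)\<^sup>2 \<le> nn h"
      unfolding nn_def using st fin by (intro member_le_sum) auto
    then have "nn h > 0" by (simp add: h_def)
    ultimately show ?thesis using normalise by blast
  qed
  then obtain f where f: "f \<in> K" and fmax: "\<And>g. g \<in> K \<Longrightarrow> q g \<le> q f"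
    using continuous_attains_sup[OF cK _ continuous_on_subset[OF cq]] by auto
  define \<mu> where "\<mu> = q f"
  have bound: "q h \<le> \<mu> * nn h" if "(\<Sum>x\<in>S. h x) = 0" for h
  proof (cases "nn h > 0")
    case True
    with normalise[OF that] fmax show ?thesis
      by (metis \<mu>_def mult.commute mult_left_mono order_less_imp_le)
  next
    case False
    moreover have "nn h \<ge> 0"
      unfolding nn_def by (intro sum_nonneg) simp
    ultimately have "nn h = 0" by simp
    then have "\<forall>x\<in>S. h x = 0"
      using fin by (simp add: nn_def sum_nonneg_eq_0_iff)
    then show ?thesis by (simp add: q_def nn_def)
  qed
  have f0: "(\<Sum>x\<in>S. f x) = 0" and fn: "nn f = 1"
    using f by (auto simp: K_def)
  define g where "g x = (\<Sum>y\<in>S. A x y * f y) - \<mu> * f x" for x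
  have "(\<Sum>x\<in>S. \<Sum>y\<in>S. A x y * f y) = (\<Sum>y\<in>S. \<Sum>x\<in>S. A y x * f y)"
    by (subst sum.swap) (intro sum.cong refl, simp add: sym)
  also have "\<dots> = R * (\<Sum>y\<in>S. f y)"
    by (simp add: rows sum_distrib_left flip: sum_distrib_right)
  finally have g0: "(\<Sum>x\<in>S. g x) = 0"
    using f0 by (simp add: g_def sum_subtractf flip: sum_distrib_left)
  have "2 * nn g * t + (q g - \<mu> * nn g) * t\<^sup>2 \<le> 0" for t
  proof -
    have s0: "(\<Sum>x\<in>S. f x + t * g x) = 0"
      using f0 g0 by (simp add: sum.distrib flip: sum_distrib_left)
    have cross: "(\<Sum>x\<in>S. f x * (\<Sum>y\<in>S. A x y * g y)) = (\<Sum>x\<in>S. g x * (\<Sum>y\<in>S. A x y * f y))"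
      unfolding sum_distrib_left
      by (subst sum.swap) (intro sum.cong refl, simp add: sym mult.left_commute)
    have "q (\<lambda>x. f x + t * g x) = (\<Sum>x\<in>S. f x * (\<Sum>y\<in>S. A x y * f y) + t * (f x * (\<Sum>y\<in>S. A x y * g y))
       + t * (g x * (\<Sum>y\<in>S. A x y * f y)) + t\<^sup>2 * (g x * (\<Sum>y\<in>S. A x y * g y)))"
      unfolding q_def
    proof (intro sum.cong refl)
      fix x
      have "(\<Sum>y\<in>S. A x y * (f y + t * g y)) = (\<Sum>y\<in>S. A x y * f y) + t * (\<Sum>y\<in>S. A x y * g y)"
        by (simp add: sum_distrib_left sum.distrib algebra_simps)
      then show "(f x + t * g x) * (\<Sum>y\<in>S. A x y * (f y + t * g y)) =
          f x * (\<Sum>y\<in>S. A x y * f y) + t * (f x * (\<Sum>y\<in>S. A x y * g y))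
       + t * (g x * (\<Sum>y\<in>S. A x y * f y)) + t\<^sup>2 * (g x * (\<Sum>y\<in>S. A x y * g y))"
        by (simp add: algebra_simps power2_eq_square)
    qed
    also have "\<dots> = q f + 2 * t * (\<Sum>x\<in>S. g x * (\<Sum>y\<in>S. A x y * f y)) + t\<^sup>2 * q g"
      by (simp only: sum.distrib cross q_def sum_distrib_left[symmetric])
    finally have 1: "q (\<lambda>x. f x + t * g x) = \<dots>" .
    have 2: "nn (\<lambda>x. f x + t * g x) = nn f + 2 * t * (\<Sum>x\<in>S. g x * f x) + t\<^sup>2 * nn g"
      unfolding nn_def sum_distrib_left sum.distrib[symmetric]
      by (intro sum.cong refl) (simp add: power2_eq_square algebra_simps)
    have "(g x)\<^sup>2 = g x * (\<Sum>y\<in>S. A x y * f y) - \<mu> * (g x * f x)" for x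
      by (subst power2_eq_square, subst (2) g_def) (simp add: algebra_simps)
    then have 3: "(\<Sum>x\<in>S. g x * (\<Sum>y\<in>S. A x y * f y)) - \<mu> * (\<Sum>x\<in>S. g x * f x) = nn g"
      by (simp only: nn_def sum_subtractf sum_distrib_left[symmetric])
    show ?thesis
      using bound[OF s0] fn unfolding 1 2 3[symmetric] \<mu>_def[symmetric]
      by (simp add: algebra_simps)
  qed
  then have "nn g = 0"
    using linear_coefficient_zero[of "2 * nn g"] by fastforce
  then have gz: "g x = 0" if "x \<in> S" for x
    using fin that by (simp add: nn_def sum_nonneg_eq_0_iff)
  show ?thesis
  proof (rule that[of f \<mu>])
    show "(\<Sum>y\<in>S. A x y * f y) = \<mu> * f x" if "x \<in> S" for x
      using gz[OF that] by (simp add: g_def)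
    show "\<exists>x\<in>S. f x \<noteq> 0"
    proof (rule ccontr)
      assume "\<not> ?thesis"
      then have "nn f = 0" by (simp add: nn_def)
      with fn show False by simp
    qed
  qed (use f0 bound in \<open>auto simp: q_def nn_def\<close>)
qed

section \<open>The second eigenvalue of a stochastic symmetric matrix\<close>

lemma sum_two_entries:
  fixes g :: "nat \<Rightarrow> real"
  assumes "i < n"
  shows "(\<Sum>l = 0..<n. (if i = l then 1 else if l = 0 then c else 0) * g l) =
           g i + (if i = 0 then 0 else c * g 0)"
proof -
  have "(\<Sum>l = 0..<n. (if i = l then 1 else if l = 0 then c else 0) * g l) =
      (\<Sum>l = 0..<n. (if i = l then g l else 0) + (if 0 = l then if i = 0 then 0 else c * g 0 else 0))"
    by (intro sum.cong refl) auto
  also have "\<dots> = g i + (if i = 0 then 0 else c * g 0)"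
    using assms by (simp add: sum.distrib)
  finally show ?thesis .
qed

lemma similar_mat_intertwined:
  assumes A: "A \<in> carrier_mat n n" and B: "B \<in> carrier_mat n n"
    and P: "P \<in> carrier_mat n n" and Q: "Q \<in> carrier_mat n n"
    and PQ: "P * Q = 1\<^sub>m n" "Q * P = 1\<^sub>m n" and AP: "A * P = P * B"
  shows "similar_mat A B"
proof (rule similar_matI)
  have "A = A * (P * Q)"
    unfolding PQ(1) by (rule right_mult_one_mat[OF A, symmetric])
  also have "\<dots> = P * B * Q"
    unfolding assoc_mult_mat[OF A P Q, symmetric] AP ..
  finally show "A = P * B * Q" .
qed (use assms in auto)

lemma mult_mat_entry:
  assumes "A \<in> carrier_mat n n" "B \<in> carrier_mat n n" "i < n" "j < n"
  shows "(A * B) $$ (i, j) = (\<Sum>l = 0..<n. A $$ (i, l) * B $$ (l, j))"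
  using assms by (auto simp: scalar_prod_def intro!: sum.cong)

text \<open>
  The constant vector 1 is an eigenvector. Exchanging the first basis vector for it turns the matrix
  into a block triangular one, whose lower block describes the action on functions modulo constants in
  the coordinates \<open>f i - f 0\<close>.
\<close>

lemma char_poly_deflate:
  fixes a :: "nat \<Rightarrow> nat \<Rightarrow> real"
  assumes rows: "\<And>i. i \<le> m \<Longrightarrow> (\<Sum>j<Suc m. a i j) = 1"
  shows "char_poly (mat (Suc m) (Suc m) (\<lambda>(i, j). a i j)) =
           [:-1, 1:] * char_poly (mat m m (\<lambda>(i, j). a (Suc i) (Suc j) - a 0 (Suc j)))"
proof -
  let ?N = "Suc m"
  let ?A = "mat ?N ?N (\<lambda>(i, j). a i j)"
  let ?D = "mat m m (\<lambda>(i, j). a (Suc i) (Suc j) - a 0 (Suc j))"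
  let ?B = "four_block_mat (mat 1 1 (\<lambda>_. 1)) (mat 1 m (\<lambda>(i, j). a 0 (Suc j))) (0\<^sub>m m 1) ?D"
  let ?P = "mat ?N ?N (\<lambda>(i, j). if i = j then 1 else if j = 0 then 1 else 0 :: real)"
  let ?Q = "mat ?N ?N (\<lambda>(i, j). if i = j then 1 else if j = 0 then -1 else 0 :: real)"
  have PQ: "?P * ?Q = 1\<^sub>m ?N"
  proof (rule eq_matI)
    fix i j assume "i < dim_row (1\<^sub>m ?N :: real mat)" "j < dim_col (1\<^sub>m ?N :: real mat)"
    then have i: "i < ?N" and j: "j < ?N" by auto
    then have "(?P * ?Q) $$ (i, j) = (\<Sum>l = 0..<?N. ?P $$ (i, l) * ?Q $$ (l, j))"
      by (simp add: scalar_prod_def del: sum.op_ivl_Suc)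
    also have "\<dots> = (\<Sum>l = 0..<?N. (if i = l then 1 else if l = 0 then 1 else 0) * ?Q $$ (l, j))"
      using i by (intro sum.cong refl) auto
    also have "\<dots> = 1\<^sub>m ?N $$ (i, j)"
      unfolding sum_two_entries[OF i] using i j by auto
    finally show "(?P * ?Q) $$ (i, j) = 1\<^sub>m ?N $$ (i, j)" .
  qed auto
  have QP: "?Q * ?P = 1\<^sub>m ?N"
  proof (rule eq_matI)
    fix i j assume "i < dim_row (1\<^sub>m ?N :: real mat)" "j < dim_col (1\<^sub>m ?N :: real mat)"
    then have i: "i < ?N" and j: "j < ?N" by auto
    then have "(?Q * ?P) $$ (i, j) = (\<Sum>l = 0..<?N. ?Q $$ (i, l) * ?P $$ (l, j))"
      by (simp add: scalar_prod_def del: sum.op_ivl_Suc)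
    also have "\<dots> = (\<Sum>l = 0..<?N. (if i = l then 1 else if l = 0 then -1 else 0) * ?P $$ (l, j))"
      using i by (intro sum.cong refl) auto
    also have "\<dots> = 1\<^sub>m ?N $$ (i, j)"
      unfolding sum_two_entries[OF i] using i j by auto
    finally show "(?Q * ?P) $$ (i, j) = 1\<^sub>m ?N $$ (i, j)" .
  qed auto
  have AP: "?A * ?P = ?P * ?B"
  proof (rule eq_matI)
    fix i j assume "i < dim_row (?P * ?B)" "j < dim_col (?P * ?B)"
    then have i: "i < Suc m" and j: "j < Suc m" by auto
    have AP: "(\<Sum>l = 0..<Suc m. a i l * (if l = j then 1 else if j = 0 then 1 else 0)) = (if j = 0 then 1 else a i j)"
    proof (cases "j = 0")
      case True
      then have "(\<Sum>l = 0..<Suc m. a i l * (if l = j then 1 else if j = 0 then 1 else 0)) = (\<Sum>l<Suc m. a i l)"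
        by (intro sum.cong) auto
      also have "\<dots> = 1"
        by (rule rows) (use i in linarith)
      finally show ?thesis unfolding True by simp
    next
      case False
      then have "(\<Sum>l = 0..<Suc m. a i l * (if l = j then 1 else if j = 0 then 1 else 0)) =
          (\<Sum>l = 0..<Suc m. if l = j then a i l else 0)"
        by (intro sum.cong refl) auto
      also have "\<dots> = a i j"
        by (subst sum.delta) (use j in auto)
      finally show ?thesis using False by (simp only: if_False)
    qed
    have "(?A * ?P) $$ (i, j) = (\<Sum>l = 0..<?N. a i l * (if l = j then 1 else if j = 0 then 1 else 0))"
      using i j by (simp add: scalar_prod_def del: sum.op_ivl_Suc)
    also have "\<dots> = ?B $$ (i, j) + (if i = 0 then 0 else 1 * ?B $$ (0, j))"
      using i j by (simp only: AP) (cases i; cases j; simp)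
    also have "\<dots> = (\<Sum>l = 0..<?N. (if i = l then 1 else if l = 0 then 1 else 0) * ?B $$ (l, j))"
      unfolding sum_two_entries[OF i] ..
    also have "\<dots> = (\<Sum>l = 0..<?N. ?P $$ (i, l) * ?B $$ (l, j))"
      using i by (intro sum.cong refl arg_cong2[of _ _ _ _ "(*)"]) auto
    also have "\<dots> = (?P * ?B) $$ (i, j)"
      by (rule mult_mat_entry[symmetric]) (use i j in auto)
    finally show "(?A * ?P) $$ (i, j) = (?P * ?B) $$ (i, j)" .
  qed auto
  have "similar_mat ?A ?B"
    by (rule similar_mat_intertwined[OF mat_carrier _ mat_carrier mat_carrier PQ QP AP])
       (rule carrier_matI, simp_all)
  then have "char_poly ?A = char_poly ?B"
    by (rule char_poly_similar)
  also have "\<dots> = char_poly (mat 1 1 (\<lambda>_. 1 :: real)) * char_poly ?D"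
    by (rule char_poly_four_block_zeros_col) auto
  also have "char_poly (mat 1 1 (\<lambda>_. 1 :: real)) = [:-1, 1:]"
    by (subst char_poly_upper_triangular[of _ 1]) (auto simp: diag_mat_def)
  finally show ?thesis .
qed

text \<open>
  Splitting off the root 1 leaves the characteristic polynomial of the action modulo constants. An
  eigenvector of this action becomes an eigenvector with sum zero of the matrix itself after
  subtracting its mean, so all remaining real roots are at most \<open>b < 1\<close>. The maximiser of the quadratic
  form shows that there is such a root; hence the second entry of the list is one of them.
\<close>

lemma second_eigenvalue_le:
  fixes A :: "'a \<Rightarrow> 'a \<Rightarrow> real"
  assumes fin: "finite S" and card: "card S \<ge> 2" and e: "bij_betw e {..<card S} S"
    and sym: "\<And>x y. x \<in> S \<Longrightarrow> y \<in> S \<Longrightarrow> A x y = A y x"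
    and rows: "\<And>x. x \<in> S \<Longrightarrow> (\<Sum>y\<in>S. A x y) = 1"
    and bound: "\<And>f \<mu>. \<lbrakk>\<And>x. x \<in> S \<Longrightarrow> (\<Sum>y\<in>S. A x y * f y) = \<mu> * f x;
       (\<Sum>x\<in>S. f x) = 0; \<exists>x\<in>S. f x \<noteq> 0\<rbrakk> \<Longrightarrow> \<mu> \<le> b"
    and b: "b < 1"
  shows "eigenvalues_desc (mat (card S) (card S) (\<lambda>(i, j). A (e i) (e j))) ! 1 \<le> b"
proof -
  obtain m where m: "card S = Suc m" and "m \<ge> 1"
    using card by (cases "card S") auto
  define a where "a i j = A (e i) (e j)" for i j
  have eS: "e i \<in> S" if "i < Suc m" for i
    using bij_betwE[OF e] that m by simp
  have reindex: "(\<Sum>y\<in>S. g y) = (\<Sum>j<Suc m. g (e j))" for g :: "'a \<Rightarrow> real"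
    unfolding m[symmetric] by (rule sum.reindex_bij_betw[OF e, symmetric])
  have arows: "(\<Sum>j<Suc m. a i j) = 1" if "i \<le> m" for i
  proof -
    have "e i \<in> S" using eS that by simp
    from rows[OF this] show ?thesis unfolding reindex a_def .
  qed
  define D where "D = mat m m (\<lambda>(i, j). a (Suc i) (Suc j) - a 0 (Suc j))"
  have cD: "D \<in> carrier_mat m m" by (simp add: D_def)
  have cp: "char_poly (mat (card S) (card S) (\<lambda>(i, j). A (e i) (e j))) = [:-1, 1:] * char_poly D"
    using char_poly_deflate[of m a] arows by (simp add: m a_def D_def)
  have nz: "char_poly D \<noteq> 0"
    using degree_monic_char_poly[OF cD] by auto
  have Dvec: "(D *\<^sub>v vec m g) $ i = (\<Sum>j<m. (a (Suc i) (Suc j) - a 0 (Suc j)) * g j)" if "i < m" for g i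
    using that by (simp add: D_def scalar_prod_def atLeast0LessThan)
  \<comment> \<open>the rows of \<open>a\<close> have equal sums, so \<open>f\<close> enters only through its differences\<close>
  have diff: "(\<Sum>j<m. (a (Suc i) (Suc j) - a 0 (Suc j)) * (f (Suc j) - f 0)) =
      (\<Sum>j<Suc m. a (Suc i) j * f j) - (\<Sum>j<Suc m. a 0 j * f j)" if "i < m" for f i
  proof -
    have "(\<Sum>j<m. (a (Suc i) (Suc j) - a 0 (Suc j)) * (f (Suc j) - f 0)) =
        (\<Sum>j<Suc m. (a (Suc i) j - a 0 j) * (f j - f 0))"
      by (simp add: sum.lessThan_Suc_shift del: sum.lessThan_Suc)
    also have "\<dots> = (\<Sum>j<Suc m. a (Suc i) j * f j) - (\<Sum>j<Suc m. a 0 j * f j)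
        - f 0 * ((\<Sum>j<Suc m. a (Suc i) j) - (\<Sum>j<Suc m. a 0 j))"
      by (simp only: sum_subtractf[symmetric] sum_distrib_left) (intro sum.cong refl, simp add: algebra_simps)
    finally show ?thesis using arows[of "Suc i"] arows[of 0] that by simp
  qed
  have roots_le: "r \<le> b" if "poly (char_poly D) r = 0" for r
  proof -
    from that eigenvalue_root_char_poly[OF cD] obtain v where "eigenvector D v r"
      by (auto simp: eigenvalue_def)
    then have v: "v \<in> carrier_vec m" "v \<noteq> 0\<^sub>v m" "D *\<^sub>v v = r \<cdot>\<^sub>v v"
      using cD by (auto simp: eigenvector_def)
    \<comment> \<open>lift the class modulo constants to the representative vanishing at 0, then centre it as \<open>g\<close>\<close>
    define f where "f i = (if i = 0 then 0 else v $ (i - 1))" for i :: nat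
    have vv: "v = vec m (\<lambda>j. f (Suc j) - f 0)"
      using v(1) by (intro eq_vecI) (auto simp: f_def)
    define c where "c = (\<Sum>j<Suc m. a 0 j * f j)"
    have f1: "(\<Sum>j<Suc m. a i j * f j) = r * f i + c" if "i \<le> m" for i
    proof (cases i)
      case 0
      then have "f i = 0" by (simp add: f_def)
      then show ?thesis using 0 by (simp only: c_def mult_zero_right add_0_left)
    next
      case (Suc i')
      with that have i': "i' < m" by simp
      have "(D *\<^sub>v v) $ i' = r * v $ i'" using v(1) i' unfolding v(3) by simp
      moreover have "(D *\<^sub>v v) $ i' = (\<Sum>j<Suc m. a (Suc i') j * f j) - c"
        unfolding c_def using Dvec[OF i', of "\<lambda>j. f (Suc j) - f 0"] diff[OF i', of f] by (simp only: flip: vv)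
      moreover have "f i = v $ i'" using Suc by (simp add: f_def)
      ultimately show ?thesis unfolding Suc by (simp only: diff_eq_eq)
    qed
    define s where "s = (\<Sum>j<Suc m. f j) / Suc m"
    define g where "g x = f (the_inv_into {..<card S} e x) - s" for x
    have ge: "g (e i) = f i - s" if "i \<le> m" for i
      using e that m by (simp add: g_def the_inv_into_f_f bij_betw_def less_Suc_eq_le)
    have g0: "(\<Sum>x\<in>S. g x) = 0"
    proof -
      have "(\<Sum>x\<in>S. g x) = (\<Sum>j<Suc m. f j - s)"
        unfolding reindex by (intro sum.cong refl ge) simp
      also have "\<dots> = (\<Sum>j<Suc m. f j) - Suc m * s"
        by (simp only: sum_subtractf sum_constant card_lessThan)
      finally show ?thesis by (simp add: s_def del: sum.lessThan_Suc)
    qed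
    define d where "d = c + r * s - s"
    have g1: "(\<Sum>y\<in>S. A x y * g y) = r * g x + d" if "x \<in> S" for x
    proof -
      obtain i where i: "i \<le> m" "x = e i"
        using e \<open>x \<in> S\<close> m by (auto simp: bij_betw_def less_Suc_eq_le)
      have "(\<Sum>y\<in>S. A x y * g y) = (\<Sum>j<Suc m. a i j * (f j - s))"
        unfolding reindex by (intro sum.cong refl) (simp add: ge i a_def)
      also have "\<dots> = (\<Sum>j<Suc m. a i j * f j) - s * (\<Sum>j<Suc m. a i j)"
        by (simp only: sum_subtractf[symmetric] sum_distrib_left) (intro sum.cong refl, simp add: algebra_simps)
      also have "\<dots> = r * g x + d"
        using i f1[of i] arows[of i] by (simp add: ge d_def algebra_simps del: sum.lessThan_Suc)
      finally show ?thesis .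
    qed
    \<comment> \<open>summing the eigenvalue equation over \<open>S\<close> shows that its constant error term vanishes\<close>
    have "(\<Sum>x\<in>S. \<Sum>y\<in>S. A x y * g y) = (\<Sum>y\<in>S. \<Sum>x\<in>S. A y x * g y)"
      by (subst sum.swap) (intro sum.cong refl, simp add: sym)
    also have "\<dots> = 0"
      using g0 by (simp add: rows flip: sum_distrib_right)
    finally have "real (card S) * d = 0"
      using g0 by (simp add: g1 sum.distrib flip: sum_distrib_left)
    then have "d = 0" using m by simp
    show ?thesis
    proof (rule bound[of g r])
      show "(\<Sum>y\<in>S. A x y * g y) = r * g x" if "x \<in> S" for x
        using g1[OF that] \<open>d = 0\<close> by simp
      show "\<exists>x\<in>S. g x \<noteq> 0"
      proof (rule ccontr)
        assume "\<not> ?thesis"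
        then have "f i = s" if "i \<le> m" for i
          using ge[OF that] eS that by (metis eq_iff_diff_eq_0 less_Suc_eq_le)
        then have "v = 0\<^sub>v m"
          by (subst vv) (auto intro!: eq_vecI)
        with v(2) show False ..
      qed
    qed fact
  qed
  have ex_root: "\<exists>r. poly (char_poly D) r = 0"
  proof -
    obtain f \<mu> where f: "\<And>x. x \<in> S \<Longrightarrow> (\<Sum>y\<in>S. A x y * f y) = \<mu> * f x"
        "(\<Sum>x\<in>S. f x) = 0" "\<exists>x\<in>S. f x \<noteq> 0"
      by (rule rayleigh_maximizer[OF fin card sym rows]) auto
    define g where "g i = f (e i)" for i
    have ag: "(\<Sum>j<Suc m. a i j * g j) = \<mu> * g i" if "i \<le> m" for i
    proof -
      have "e i \<in> S" using eS that by simp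
      from f(1)[OF this] show ?thesis unfolding reindex a_def g_def .
    qed
    define v where "v = vec m (\<lambda>j. g (Suc j) - g 0)"
    have "D *\<^sub>v v = \<mu> \<cdot>\<^sub>v v"
    proof (rule eq_vecI)
      fix i assume "i < dim_vec (\<mu> \<cdot>\<^sub>v v)"
      then have i: "i < m" by (simp add: v_def)
      then show "(D *\<^sub>v v) $ i = (\<mu> \<cdot>\<^sub>v v) $ i"
        unfolding v_def Dvec[OF i] diff[OF i] using ag[of "Suc i"] ag[of 0]
        by (simp add: algebra_simps del: sum.lessThan_Suc)
    qed (use cD in \<open>simp add: v_def\<close>)
    moreover have "v \<noteq> 0\<^sub>v m"
    proof
      assume v0: "v = 0\<^sub>v m"
      have const: "g i = g 0" if "i \<le> m" for i
      proof (cases i)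
        case (Suc i')
        then have "v $ i' = 0" using v0 that by simp
        then show ?thesis using Suc that by (simp add: v_def)
      qed simp
      have "(\<Sum>x\<in>S. f x) = (\<Sum>j<Suc m. g 0)"
        unfolding reindex by (intro sum.cong refl) (metis const g_def less_Suc_eq_le lessThan_iff)
      then have "g 0 = 0" using f(2) by (simp only: sum_constant card_lessThan) simp
      then have "f x = 0" if "x \<in> S" for x
        using that e m const by (auto simp: bij_betw_def less_Suc_eq_le g_def)
      with f(3) show False by blast
    qed
    moreover have "v \<in> carrier_vec m" by (simp add: v_def)
    ultimately have "eigenvector D v \<mu>"
      using cD by (auto simp: eigenvector_def)
    then show ?thesis
      using eigenvalue_root_char_poly[OF cD] by (auto simp: eigenvalue_def)
  qed
  define xs where "xs = sorted_list_of_multiset (proots (char_poly D))"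
  have set_xs: "set xs = {r. poly (char_poly D) r = 0}"
    using nz by (simp add: xs_def)
  have "proots ([:-1, 1:] * char_poly D) = add_mset 1 (proots (char_poly D))"
    using nz by (subst proots_mult) auto
  also have "\<dots> = mset (xs @ [1])"
    by (simp add: xs_def)
  finally have "sorted_list_of_multiset (proots ([:-1, 1:] * char_poly D)) = sort (xs @ [1])"
    by (simp only: sorted_list_of_multiset_mset)
  also have "\<dots> = xs @ [1]"
    using roots_le b set_xs by (intro sorted_sort_id) (force simp: sorted_append xs_def)
  finally have "eigenvalues_desc (mat (card S) (card S) (\<lambda>(i, j). A (e i) (e j))) = 1 # rev xs"
    unfolding eigenvalues_desc_def cp by simp
  moreover have "xs \<noteq> []"
    using ex_root set_xs by auto
  ultimately have "eigenvalues_desc (mat (card S) (card S) (\<lambda>(i, j). A (e i) (e j))) ! 1 \<in> set xs"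
    by (cases "rev xs") (auto simp: rev_eq_Cons_iff)
  then show ?thesis using roots_le set_xs by auto
qed

section \<open>Moving one letter of a word\<close>

text \<open>
  Positions in a word are counted from 0. Carrying the letter at position \<open>i\<close> to position \<open>j\<close> by
  adjacent swaps, and taking it out and reinserting it, have the same effect; the second description
  is the one that underlies \<open>shuffle_op\<close>.
\<close>

definition swap_adj :: "nat \<Rightarrow> 'a list \<Rightarrow> 'a list" where
  "swap_adj i w = w[i := w ! Suc i, Suc i := w ! i]"

definition ins_at :: "nat \<Rightarrow> 'a \<Rightarrow> 'a list \<Rightarrow> 'a list" where
  "ins_at j x u = take j u @ x # drop j u"

definition del_at :: "nat \<Rightarrow> 'a list \<Rightarrow> 'a list" where
  "del_at i w = take i w @ drop (Suc i) w"

definition move :: "nat \<Rightarrow> nat \<Rightarrow> 'a list \<Rightarrow> 'a list" where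
  "move i j w = ins_at j (w ! i) (del_at i w)"

lemma length_swap_adj [simp]: "length (swap_adj i w) = length w"
  by (simp add: swap_adj_def)

lemma length_ins_at [simp]: "length (ins_at j x u) = Suc (length u)"
  by (simp add: ins_at_def)

lemma length_del_at [simp]: "i < length w \<Longrightarrow> length (del_at i w) = length w - 1"
  by (simp add: del_at_def)

lemma length_move [simp]: "i < length w \<Longrightarrow> length (move i j w) = length w"
  by (simp add: move_def)

lemma nth_ins_at: "j \<le> length u \<Longrightarrow> ins_at j x u ! j = x"
  by (simp add: ins_at_def nth_append)

lemma del_ins_at: "j \<le> length u \<Longrightarrow> del_at j (ins_at j x u) = u"
  by (simp add: ins_at_def del_at_def)

lemma move_self: "i < length w \<Longrightarrow> move i i w = w"
  by (simp add: move_def ins_at_def del_at_def id_take_nth_drop[symmetric] min_def)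

lemma nth_move: "i < length w \<Longrightarrow> j < length w \<Longrightarrow> move i j w ! j = w ! i"
  by (simp add: move_def nth_ins_at)

lemma move_move: "i < length w \<Longrightarrow> j < length w \<Longrightarrow> move j l (move i j w) = move i l w"
  by (simp add: move_def nth_ins_at del_ins_at)

lemma move_eq_iff:
  assumes "i < length w" "j < length w" "length w0 = length w"
  shows "move i j w = w0 \<longleftrightarrow> w = move j i w0"
proof -
  have "move j i (move i j w) = w" "move i j (move j i w0) = w0"
    using assms by (simp_all add: move_move move_self)
  then show ?thesis by metis
qed

lemma mset_move: "i < length w \<Longrightarrow> mset (move i j w) = mset w"
proof -
  assume i: "i < length w"
  have "mset (ins_at j x u) = add_mset x (mset u)" for x and u :: "'a list"
  proof -
    have "mset (take j u) + mset (drop j u) = mset u"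
      by (simp flip: mset_append)
    then show ?thesis by (simp add: ins_at_def)
  qed
  then have "mset (move i j w) = add_mset (w ! i) (mset (del_at i w))"
    by (simp add: move_def)
  also have "\<dots> = mset (take i w @ w ! i # drop (Suc i) w)"
    by (simp add: del_at_def)
  finally show ?thesis using i by (simp flip: id_take_nth_drop)
qed

lemma swap_adj_ins_at:
  assumes "j < length u"
  shows "swap_adj j (ins_at j x u) = ins_at (Suc j) x u"
    and "swap_adj j (ins_at (Suc j) x u) = ins_at j x u"
proof -
  obtain p y s where u: "u = p @ y # s" and j: "j = length p"
    using assms by (metis id_take_nth_drop length_take min.absorb4)
  show "swap_adj j (ins_at j x u) = ins_at (Suc j) x u"
    "swap_adj j (ins_at (Suc j) x u) = ins_at j x u"
    unfolding u j by (simp_all add: swap_adj_def ins_at_def nth_append list_update_append)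
qed

lemma swap_adj_move:
  assumes "i < length w" "Suc j < length w"
  shows "swap_adj j (move i j w) = move i (Suc j) w"
    and "swap_adj j (move i (Suc j) w) = move i j w"
  using assms by (simp_all add: move_def swap_adj_ins_at)

lemma del_letter_sum: "del_letter b v u = (\<Sum>p\<le>length u. v (ins_at p b u))"
proof (induction u arbitrary: v)
  case (Cons x u)
  show ?case
    by (simp add: sum.atMost_Suc_shift Cons ins_at_def del: sum.atMost_Suc)
qed (simp add: ins_at_def)

lemma ins_letter_sum:
  "ins_letter a v w = (\<Sum>i<length w. if w ! i = a then v (del_at i w) else 0)"
proof (induction w arbitrary: v)
  case (Cons x w)
  show ?case
    by (simp add: sum.lessThan_Suc_shift Cons del_at_def cong: if_cong del: sum.lessThan_Suc)
qed simp

lemma shuffle_op_sum: "shuffle_op v w = (\<Sum>i<length w. \<Sum>j<length w. v (move i j w))"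
proof -
  have "shuffle_op v w = (\<Sum>i<length w. del_letter (w ! i) v (del_at i w))"
    unfolding shuffle_op_def ins_letter_sum sum.distrib[symmetric]
    by (intro sum.cong refl) auto
  also have "\<dots> = (\<Sum>i<length w. \<Sum>j<length w. v (move i j w))"
  proof (intro sum.cong refl)
    fix i assume "i \<in> {..<length w}"
    then have "{..length (del_at i w)} = {..<length w}" by auto
    then show "del_letter (w ! i) v (del_at i w) = (\<Sum>j<length w. v (move i j w))"
      by (simp add: del_letter_sum move_def)
  qed
  finally show ?thesis .
qed

lemma sum_rotate:
  "(\<Sum>w\<in>S. \<Sum>i\<in>I. \<Sum>j\<in>J. g w i j) = (\<Sum>i\<in>I. \<Sum>j\<in>J. \<Sum>w\<in>S. g w i j :: real)"
proof -
  have "(\<Sum>w\<in>S. \<Sum>i\<in>I. \<Sum>j\<in>J. g w i j) = (\<Sum>i\<in>I. \<Sum>w\<in>S. \<Sum>j\<in>J. g w i j)"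
    by (rule sum.swap)
  also have "\<dots> = (\<Sum>i\<in>I. \<Sum>j\<in>J. \<Sum>w\<in>S. g w i j)"
    by (rule sum.cong[OF refl]) (rule sum.swap)
  finally show ?thesis .
qed

text \<open>
  The operators \<open>T\<^sub>i\<^sub>,\<^sub>j\<close> for an arbitrary family of elementary steps, so that they can be compared on
  linear extensions and on words.
\<close>

definition run :: "(nat \<Rightarrow> 's \<Rightarrow> 's) \<Rightarrow> nat \<Rightarrow> nat \<Rightarrow> 's \<Rightarrow> 's" where
  "run s i j = fold s (if i \<le> j then [i..<j] else rev [j..<i])"

lemma run_self: "run s i i x = x"
  by (simp add: run_def)

lemma run_up: "i \<le> j \<Longrightarrow> run s i (Suc j) x = s j (run s i j x)"
  by (simp add: run_def)

lemma run_down: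
  assumes "j < i"
  shows "run s i j x = s j (run s i (Suc j) x)"
proof -
  have "run s i j x = s j (fold s (rev [Suc j..<i]) x)"
    using assms by (simp add: run_def upt_conv_Cons)
  also have "fold s (rev [Suc j..<i]) x = run s i (Suc j) x"
    using assms by (cases "i = Suc j") (simp_all add: run_def)
  finally show ?thesis .
qed

lemma finite_binary_words [simp]: "finite (binary_words k l)"
  by (rule finite_subset[of _ "{w. length w = k + l}"]) (auto simp: length_binary_words)

lemma move_binary_words: "w \<in> binary_words k l \<Longrightarrow> i < k + l \<Longrightarrow> move i j w \<in> binary_words k l"
  using length_binary_words[of w k l] by (simp add: binary_words_def mset_move)

lemma bij_betw_move:
  assumes "i < k + l" "j < k + l"
  shows "bij_betw (move i j) (binary_words k l) (binary_words k l)"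
  by (rule bij_betw_byWitness[of _ "move j i"])
     (use assms in \<open>auto simp: move_binary_words move_move move_self length_binary_words\<close>)

lemma sum_shuffle_op: "(\<Sum>w\<in>binary_words k l. shuffle_op v w) = (real (k + l))\<^sup>2 * (\<Sum>w\<in>binary_words k l. v w)"
proof -
  have "(\<Sum>w\<in>binary_words k l. shuffle_op v w) = (\<Sum>w\<in>binary_words k l. \<Sum>i<k+l. \<Sum>j<k+l. v (move i j w))"
    by (intro sum.cong refl) (simp add: shuffle_op_sum length_binary_words)
  also have "\<dots> = (\<Sum>i<k+l. \<Sum>j<k+l. \<Sum>w\<in>binary_words k l. v (move i j w))"
    by (rule sum_rotate)
  also have "\<dots> = (\<Sum>i<k+l. \<Sum>j<k+l. \<Sum>w\<in>binary_words k l. v w)"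
    by (intro sum.cong refl sum.reindex_bij_betw bij_betw_move) auto
  finally show ?thesis by (simp add: power2_eq_square)
qed

abbreviation sorted_word :: "nat \<Rightarrow> nat \<Rightarrow> bool list" where
  "sorted_word k l \<equiv> replicate k False @ replicate l True"

lemma sorted_word_binary_words [simp]: "sorted_word k l \<in> binary_words k l"
  by (simp add: binary_words_def)

text \<open>Equal letters of the sorted word are interchangeable: only the letter that is carried matters.\<close>

lemma move_sorted_word_cong:
  assumes "i < k \<and> i' < k \<or> k \<le> i \<and> i < k + l \<and> k \<le> i' \<and> i' < k + l"
  shows "move i j (sorted_word k l) = move i' j (sorted_word k l)"
proof -
  have 1: "del_at a (sorted_word k l) = sorted_word (k - 1) l" if "a < k" for a
    using that by (simp add: del_at_def flip: append_assoc replicate_add)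
  have 2: "del_at a (sorted_word k l) = sorted_word k (l - 1)" if "k \<le> a" "a < k + l" for a
    using that by (simp add: del_at_def min_def Suc_diff_le flip: replicate_add)
  show ?thesis
    using assms 1 2 by (auto simp: move_def nth_append)
qed

lemma move_sorted_word_same:
  assumes "i < k \<and> j < k \<or> k \<le> i \<and> i < k + l \<and> k \<le> j \<and> j < k + l"
  shows "move i j (sorted_word k l) = sorted_word k l"
  using move_sorted_word_cong[OF assms, of j] assms by (auto simp: move_self)

lemma move_sorted_word_neq:
  assumes "i < k + l" "j < k + l" "i < k \<longleftrightarrow> k \<le> j"
  shows "move i j (sorted_word k l) \<noteq> sorted_word k l"
  using nth_move[of i "sorted_word k l" j] assms by (auto simp: nth_append not_le)

lemma binary_words_card_ge2:
  assumes "k \<ge> 1" "l \<ge> 1"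
  shows "card (binary_words k l) \<ge> 2"
proof -
  have "card {sorted_word k l, move 0 k (sorted_word k l)} \<le> card (binary_words k l)"
    using assms by (intro card_mono) (auto simp: move_binary_words)
  then show ?thesis
    using move_sorted_word_neq[of 0 k l k] assms by (simp add: eq_commute)
qed

text \<open>
  \<open>move j i\<close> undoes \<open>move i j\<close>, so the shuffle is given by a symmetric matrix, and it suffices to bound the
  eigenvalue of a maximiser of its quadratic form. Extended by zero to the words of other content, the
  maximiser is an eigenvector of \<open>shuffle_op\<close>.
\<close>

lemma two_chain_rayleigh_bound:
  assumes "k \<ge> 1" "l \<ge> 1" and h0: "(\<Sum>w\<in>binary_words k l. h w) = 0"
  shows "(\<Sum>w\<in>binary_words k l. h w * shuffle_op h w)
           \<le> (real (k + l) + 1) * (real (k + l) - 2) * (\<Sum>w\<in>binary_words k l. (h w)\<^sup>2)"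
proof -
  let ?W = "binary_words k l" and ?n = "k + l"
  define A where "A w w' = (\<Sum>i<?n. \<Sum>j<?n. of_bool (move i j w = w') :: real)" for w w' :: "bool list"
  have Aact: "(\<Sum>w'\<in>?W. A w w' * g w') = shuffle_op g w" if w: "w \<in> ?W" for w and g :: "bool list \<Rightarrow> real"
  proof -
    have "(\<Sum>w'\<in>?W. A w w' * g w') = (\<Sum>w'\<in>?W. \<Sum>i<?n. \<Sum>j<?n. of_bool (move i j w = w') * g w')"
      by (simp add: A_def sum_distrib_right)
    also have "\<dots> = (\<Sum>i<?n. \<Sum>j<?n. \<Sum>w'\<in>?W. of_bool (move i j w = w') * g w')"
      by (rule sum_rotate)
    also have "\<dots> = (\<Sum>i<?n. \<Sum>j<?n. g (move i j w))"
    proof (intro sum.cong refl)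
      fix i j assume "i \<in> {..<?n}" "j \<in> {..<?n}"
      then have "move i j w \<in> ?W" using w by (simp add: move_binary_words)
      moreover have "(\<Sum>w'\<in>?W. of_bool (move i j w = w') * g w') =
          (\<Sum>w'\<in>?W. if move i j w = w' then g w' else 0)"
        by (intro sum.cong) auto
      ultimately show "(\<Sum>w'\<in>?W. of_bool (move i j w = w') * g w') = g (move i j w)"
        by simp
    qed
    finally show ?thesis using w by (simp add: shuffle_op_sum length_binary_words)
  qed
  have sym: "A w w' = A w' w" if "w \<in> ?W" "w' \<in> ?W" for w w'
    unfolding A_def
  proof (subst sum.swap, intro sum.cong refl)
    fix i j assume "i \<in> {..<?n}" "j \<in> {..<?n}"
    then have "move j i w = w' \<longleftrightarrow> move i j w' = w"
      using move_eq_iff[of j w i w'] that by (auto simp: length_binary_words)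
    then show "of_bool (move j i w = w') = (of_bool (move i j w' = w) :: real)" by simp
  qed
  have rows: "(\<Sum>w'\<in>?W. A w w') = (real ?n)\<^sup>2" if "w \<in> ?W" for w
    using Aact[OF that, of "\<lambda>_. 1"] that by (simp add: shuffle_op_sum length_binary_words power2_eq_square)
  obtain f \<mu> where f: "\<And>w. w \<in> ?W \<Longrightarrow> (\<Sum>w'\<in>?W. A w w' * f w') = \<mu> * f w"
      "(\<Sum>w\<in>?W. f w) = 0" "\<exists>w\<in>?W. f w \<noteq> 0"
    and max: "\<And>h. (\<Sum>w\<in>?W. h w) = 0 \<Longrightarrow>
       (\<Sum>w\<in>?W. h w * (\<Sum>w'\<in>?W. A w w' * h w')) \<le> \<mu> * (\<Sum>w\<in>?W. (h w)\<^sup>2)"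
    using rayleigh_maximizer[OF finite_binary_words binary_words_card_ge2[OF assms(1,2)] sym rows] by blast
  define v where "v w = (if w \<in> ?W then f w else 0)" for w
  have "supported k l v"
    by (auto simp: supported_def v_def binary_words_def)
  moreover have "word_sum ?n v = 0"
  proof -
    have "word_sum ?n v = (\<Sum>w\<in>?W. v w)"
      unfolding word_sum_def by (rule sum.mono_neutral_right) (auto simp: length_binary_words v_def)
    then show ?thesis using f(2) by (simp add: v_def)
  qed
  moreover have "shuffle_op v w = \<mu> * v w" for w
  proof (cases "w \<in> ?W")
    case True
    have "shuffle_op v w = (\<Sum>w'\<in>?W. A w w' * f w')"
      unfolding Aact[OF True, symmetric] by (intro sum.cong) (auto simp: v_def)
    then show ?thesis using f(1)[OF True] True by (simp add: v_def)
  next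
    case False
    have "move i j w \<notin> ?W" if "i < length w" for i j
      using False that by (simp add: binary_words_def mset_move)
    then show ?thesis using False by (simp add: shuffle_op_sum v_def)
  qed
  moreover obtain w0 where w0: "w0 \<in> ?W" "f w0 \<noteq> 0"
    using f(3) by blast
  moreover have "v w0 \<noteq> 0"
    using w0 by (simp add: v_def)
  ultimately have \<mu>: "\<mu> \<le> (real ?n + 1) * (real ?n - 2)"
    by (intro shuffle_op_eigenvalue_bound)
  have "(\<Sum>w\<in>?W. h w * shuffle_op h w) = (\<Sum>w\<in>?W. h w * (\<Sum>w'\<in>?W. A w w' * h w'))"
    by (intro sum.cong refl) (simp add: Aact)
  also have "\<dots> \<le> \<mu> * (\<Sum>w\<in>?W. (h w)\<^sup>2)"
    by (rule max[OF h0])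
  also have "\<dots> \<le> (real ?n + 1) * (real ?n - 2) * (\<Sum>w\<in>?W. (h w)\<^sup>2)"
    using \<mu> by (intro mult_right_mono sum_nonneg) auto
  finally show ?thesis .
qed

section \<open>Suppressing the sorted word\<close>

definition avoid_swap :: "'a list \<Rightarrow> nat \<Rightarrow> 'a list \<Rightarrow> 'a list" where
  "avoid_swap w0 i w = (if swap_adj i w = w0 then w else swap_adj i w)"

text \<open>
  The swaps carry the letter as usual unless one of them would produce the sorted word \<open>w\<^sub>0\<close>. This
  happens only if the word is \<open>move j i w\<^sub>0\<close> with \<open>i\<close> and \<open>j\<close> on different sides, and then at the swap of
  the positions \<open>k - 1\<close> and \<open>k\<close>. The following swaps pick up the other letter, which
  stands at position \<open>k\<close>, and carry it across the second half of the word.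
\<close>

lemma run_avoid_up:
  fixes k l :: nat
  defines "w0 \<equiv> sorted_word k l" and "n \<equiv> k + l"
  assumes "i \<le> j" "j < n" "length w = n" "w \<noteq> w0"
  shows "run (avoid_swap w0) i j w =
           (if i < k \<and> k \<le> j \<and> w = move j i w0 then move i j w0 else move i j w)"
  using assms(3,4)
proof (induction j rule: dec_induct)
  case base
  then show ?case using assms(5) by (simp add: run_self move_self)
next
  case (step j)
  have lw0: "length w0 = n" by (simp add: w0_def n_def)
  have i: "i < n" "Suc j < n" "j < n" using step by auto
  have IH: "run (avoid_swap w0) i j w =
       (if i < k \<and> k \<le> j \<and> w = move j i w0 then move i j w0 else move i j w)"
    using step.IH i by simp
  have run: "run (avoid_swap w0) i (Suc j) w = avoid_swap w0 j (run (avoid_swap w0) i j w)"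
    using step.hyps by (simp add: run_up)
  have stay: "avoid_swap w0 j (move i j w) =
      (if move i (Suc j) w = w0 then move i j w else move i (Suc j) w)"
    using i assms(5) by (simp add: avoid_swap_def swap_adj_move)
  have hit: "move i (Suc j) w = w0 \<longleftrightarrow> w = move (Suc j) i w0"
    by (rule move_eq_iff) (use i assms(5) lw0 in auto)
  show ?case
  proof (cases "i < k \<and> k \<le> Suc j \<and> w = move (Suc j) i w0")
    case True
    show ?thesis
    proof (cases "k \<le> j")
      case kj: True
      have "move (Suc j) i w0 = move j i w0"
        unfolding w0_def by (rule move_sorted_word_cong) (use kj i in \<open>auto simp: n_def\<close>)
      then have "run (avoid_swap w0) i j w = move i j w0"
        using IH True kj by simp
      moreover have "move i (Suc j) w0 \<noteq> w0"
        unfolding w0_def by (rule move_sorted_word_neq) (use True kj i in \<open>auto simp: n_def\<close>)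
      ultimately have "run (avoid_swap w0) i (Suc j) w = move i (Suc j) w0"
        unfolding run using i lw0 by (simp add: avoid_swap_def swap_adj_move)
      then show ?thesis unfolding if_P[OF True] .
    next
      case False
      with True have k: "k = Suc j" by simp
      \<comment> \<open>the swap that would reach \<open>w0\<close> is suppressed; the word then is the one in which the other
        letter has just been carried from the first half of \<open>w0\<close> to position \<open>k\<close>\<close>
      have "run (avoid_swap w0) i (Suc j) w = move i j w"
        using run IH False stay hit True by simp
      also have "\<dots> = move (Suc j) j w0"
        using True i lw0 by (simp add: move_move)
      also have "\<dots> = swap_adj j w0"
        using swap_adj_move(2)[of "Suc j" w0 j] i lw0 by (simp add: move_self)
      also have "\<dots> = move j (Suc j) w0"
        using swap_adj_move(1)[of j w0 j] i lw0 by (simp add: move_self)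
      also have "\<dots> = move i (Suc j) w0"
        unfolding w0_def by (rule move_sorted_word_cong) (use True k in auto)
      finally show ?thesis unfolding if_P[OF True] .
    qed
  next
    case False
    have "move i (Suc j) w \<noteq> w0"
    proof
      assume "move i (Suc j) w = w0"
      with hit False have "\<not> (i < k \<and> k \<le> Suc j)" "w = move (Suc j) i w0" by auto
      moreover from this(1) have "move (Suc j) i w0 = w0"
        unfolding w0_def by (intro move_sorted_word_same) (use step.hyps i in \<open>auto simp: n_def\<close>)
      ultimately show False using assms(6) by simp
    qed
    moreover have "run (avoid_swap w0) i j w = move i j w"
    proof (cases "i < k \<and> k \<le> j \<and> w = move j i w0")
      case True
      have "move (Suc j) i w0 = move j i w0"
        unfolding w0_def by (rule move_sorted_word_cong) (use True i in \<open>auto simp: n_def\<close>)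
      with True False show ?thesis by simp
    qed (use IH in auto)
    ultimately have "run (avoid_swap w0) i (Suc j) w = move i (Suc j) w"
      using run stay by simp
    then show ?thesis unfolding if_not_P[OF False] .
  qed
qed

text \<open>
  In the opposite direction the suppressed swap leaves the other letter at position \<open>k - 1\<close>, from where
  it is carried across the first half of the word.
\<close>

lemma run_avoid_down:
  fixes k l :: nat
  defines "w0 \<equiv> sorted_word k l" and "n \<equiv> k + l"
  assumes "j \<le> i" "i < n" "length w = n" "w \<noteq> w0"
  shows "run (avoid_swap w0) i j w =
           (if j < k \<and> k \<le> i \<and> w = move j i w0 then move i j w0 else move i j w)"
  using assms(3)
proof (induction j rule: inc_induct)
  case base
  then show ?case using assms(4,5) by (simp add: run_self move_self)
next
  case (step j)
  have lw0: "length w0 = n" by (simp add: w0_def n_def)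
  have i: "i < n" "Suc j < n" "j < n" "j < i" using step assms(4) by auto
  have IH: "run (avoid_swap w0) i (Suc j) w =
       (if Suc j < k \<and> k \<le> i \<and> w = move (Suc j) i w0 then move i (Suc j) w0 else move i (Suc j) w)"
    by (rule step.IH)
  have run: "run (avoid_swap w0) i j w = avoid_swap w0 j (run (avoid_swap w0) i (Suc j) w)"
    using i by (simp add: run_down)
  have stay: "avoid_swap w0 j (move i (Suc j) w) =
      (if move i j w = w0 then move i (Suc j) w else move i j w)"
    using i assms(5) by (simp add: avoid_swap_def swap_adj_move)
  have hit: "move i j w = w0 \<longleftrightarrow> w = move j i w0"
    by (rule move_eq_iff) (use i assms(5) lw0 in auto)
  show ?case
  proof (cases "j < k \<and> k \<le> i \<and> w = move j i w0")
    case True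
    show ?thesis
    proof (cases "Suc j < k")
      case kj: True
      have "move (Suc j) i w0 = move j i w0"
        unfolding w0_def by (rule move_sorted_word_cong) (use kj i in \<open>auto simp: n_def\<close>)
      then have "run (avoid_swap w0) i (Suc j) w = move i (Suc j) w0"
        using IH True kj by simp
      moreover have "move i j w0 \<noteq> w0"
        unfolding w0_def by (rule move_sorted_word_neq) (use True kj i in \<open>auto simp: n_def\<close>)
      ultimately have "run (avoid_swap w0) i j w = move i j w0"
        unfolding run using i lw0 by (simp add: avoid_swap_def swap_adj_move)
      then show ?thesis unfolding if_P[OF True] .
    next
      case False
      with True have k: "k = Suc j" by simp
      have "run (avoid_swap w0) i j w = move i (Suc j) w"
        using run IH False stay hit True by simp
      also have "\<dots> = move j (Suc j) w0"
        using True i lw0 by (simp add: move_move)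
      also have "\<dots> = swap_adj j w0"
        using swap_adj_move(1)[of j w0 j] i lw0 by (simp add: move_self)
      also have "\<dots> = move (Suc j) j w0"
        using swap_adj_move(2)[of "Suc j" w0 j] i lw0 by (simp add: move_self)
      also have "\<dots> = move i j w0"
        unfolding w0_def by (rule move_sorted_word_cong) (use True k i in \<open>auto simp: n_def\<close>)
      finally show ?thesis unfolding if_P[OF True] .
    qed
  next
    case False
    have "move i j w \<noteq> w0"
    proof
      assume "move i j w = w0"
      with hit False have "\<not> (j < k \<and> k \<le> i)" "w = move j i w0" by auto
      moreover from this(1) have "move j i w0 = w0"
        unfolding w0_def by (intro move_sorted_word_same) (use i in \<open>auto simp: n_def\<close>)
      ultimately show False using assms(6) by simp
    qed
    moreover have "run (avoid_swap w0) i (Suc j) w = move i (Suc j) w"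
    proof (cases "Suc j < k \<and> k \<le> i \<and> w = move (Suc j) i w0")
      case True
      have "move (Suc j) i w0 = move j i w0"
        unfolding w0_def by (rule move_sorted_word_cong) (use True i in \<open>auto simp: n_def\<close>)
      with True False show ?thesis by simp
    qed (use IH in auto)
    ultimately have "run (avoid_swap w0) i j w = move i j w"
      using run stay by simp
    then show ?thesis unfolding if_not_P[OF False] .
  qed
qed

lemma run_avoid:
  assumes "i < k + l" "j < k + l" "length w = k + l" "w \<noteq> sorted_word k l"
  shows "run (avoid_swap (sorted_word k l)) i j w =
    (if (i < k \<longleftrightarrow> k \<le> j) \<and> w = move j i (sorted_word k l) then move i j (sorted_word k l) else move i j w)"
proof (cases "i \<le> j")
  case True
  then show ?thesis using run_avoid_up[OF True, of k l w] assms by auto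
next
  case False
  then show ?thesis using run_avoid_down[of j i k l w] assms by auto
qed

text \<open>
  The two shuffles differ in the moves with \<open>cross i j\<close>. Each such move contributes
  \<open>- (F x - F w\<^sub>0) (F y - F w\<^sub>0)\<close> to the difference of the two quadratic forms, where \<open>x\<close> is one of the words
  \<open>move k i w\<^sub>0\<close> with \<open>i < k\<close> and \<open>y\<close> one of the words \<open>move 0 j w\<^sub>0\<close> with \<open>k \<le> j\<close>, and all pairs occur
  equally often. So the sum of these contributions factors, and it vanishes by the choice of \<open>F w\<^sub>0\<close>. The
  remaining term \<open>n\<^sup>2 (F w\<^sub>0)\<^sup>2\<close> is what makes the two Dirichlet forms agree.
\<close>

lemma comparison_identity:
  fixes F :: "bool list \<Rightarrow> real" and k l :: nat
  defines "w0 \<equiv> sorted_word k l" and "n \<equiv> k + l"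
  assumes "k \<ge> 1" "l \<ge> 1"
    and mean: "(\<Sum>i<k. F (move k i w0)) = real k * F w0"
  shows "(\<Sum>w\<in>binary_words k l. F w * shuffle_op F w) =
    (\<Sum>w\<in>binary_words k l - {w0}. F w * (\<Sum>i<n. \<Sum>j<n. F (run (avoid_swap w0) i j w)))
      + (real n)\<^sup>2 * (F w0)\<^sup>2"
proof -
  let ?W = "binary_words k l" and ?W' = "binary_words k l - {w0}"
  define cross where "cross i j \<longleftrightarrow> (i < k \<longleftrightarrow> k \<le> j)" for i j
  have w0: "w0 \<in> ?W" "length w0 = n" by (auto simp: w0_def n_def)
  have cross_W': "move j i w0 \<in> ?W'" if "i < n" "j < n" "cross i j" for i j
    using that move_binary_words[OF w0(1), of j i] move_sorted_word_neq[of j k l i]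
    by (auto simp: w0_def n_def cross_def)
  have same: "move i j w0 = w0" if "i < n" "j < n" "\<not> cross i j" for i j
    unfolding w0_def by (rule move_sorted_word_same) (use that in \<open>auto simp: n_def cross_def\<close>)
  have run: "F (run (avoid_swap w0) i j w) = F (move i j w) +
      (if w = move j i w0 then if cross i j then F (move i j w0) - F w0 else 0 else 0)"
    if "i < n" "j < n" "w \<in> ?W'" for i j w
    using run_avoid[of i k l j w] that length_binary_words[of w k l] w0
    by (auto simp: w0_def n_def cross_def move_move move_self)
  \<comment> \<open>for a fixed crossing move there is exactly one word on which the two shuffles disagree\<close>
  have "(\<Sum>w\<in>?W'. F w * (\<Sum>i<n. \<Sum>j<n. F (run (avoid_swap w0) i j w))) =
      (\<Sum>w\<in>?W'. \<Sum>i<n. \<Sum>j<n. F w * F (run (avoid_swap w0) i j w))"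
    by (simp add: sum_distrib_left)
  also have "\<dots> = (\<Sum>i<n. \<Sum>j<n. \<Sum>w\<in>?W'. F w * F (run (avoid_swap w0) i j w))"
    by (rule sum_rotate)
  also have "\<dots> = (\<Sum>i<n. \<Sum>j<n. (\<Sum>w\<in>?W'. F w * F (move i j w)) +
      (if cross i j then F (move j i w0) * (F (move i j w0) - F w0) else 0))"
  proof (intro sum.cong refl)
    fix i j assume "i \<in> {..<n}" "j \<in> {..<n}"
    then have ij: "i < n" "j < n" by auto
    have "(\<Sum>w\<in>?W'. F w * F (run (avoid_swap w0) i j w)) =
        (\<Sum>w\<in>?W'. F w * F (move i j w) +
          (if w = move j i w0 then if cross i j then F (move j i w0) * (F (move i j w0) - F w0) else 0 else 0))"
      by (intro sum.cong refl) (simp add: run[OF ij] distrib_left)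
    also have "\<dots> = (\<Sum>w\<in>?W'. F w * F (move i j w)) +
        (if cross i j then F (move j i w0) * (F (move i j w0) - F w0) else 0)"
      using cross_W'[OF ij] by (auto simp: sum.distrib)
    finally show "(\<Sum>w\<in>?W'. F w * F (run (avoid_swap w0) i j w)) = \<dots>" .
  qed
  also have "\<dots> = (\<Sum>i<n. \<Sum>j<n. \<Sum>w\<in>?W'. F w * F (move i j w)) +
      (\<Sum>i<n. \<Sum>j<n. if cross i j then F (move j i w0) * (F (move i j w0) - F w0) else 0)"
    by (simp add: sum.distrib)
  finally have B1: "(\<Sum>w\<in>?W'. F w * (\<Sum>i<n. \<Sum>j<n. F (run (avoid_swap w0) i j w))) = \<dots>" .
  have "(\<Sum>w\<in>?W. F w * shuffle_op F w) = (\<Sum>w\<in>?W. \<Sum>i<n. \<Sum>j<n. F w * F (move i j w))"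
    by (intro sum.cong refl) (simp add: shuffle_op_sum length_binary_words n_def sum_distrib_left)
  also have "\<dots> = (\<Sum>i<n. \<Sum>j<n. \<Sum>w\<in>?W. F w * F (move i j w))"
    by (rule sum_rotate)
  also have "\<dots> = (\<Sum>i<n. \<Sum>j<n. F w0 * F (move i j w0) + (\<Sum>w\<in>?W'. F w * F (move i j w)))"
    by (intro sum.cong refl sum.remove) (use w0 in auto)
  also have "\<dots> = (\<Sum>i<n. \<Sum>j<n. F w0 * F (move i j w0)) + (\<Sum>i<n. \<Sum>j<n. \<Sum>w\<in>?W'. F w * F (move i j w))"
    by (simp add: sum.distrib)
  finally have B0: "(\<Sum>w\<in>?W. F w * shuffle_op F w) = \<dots>" .
  have "(\<Sum>i<n. \<Sum>j<n. F w0 * F (move i j w0)) -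
      (\<Sum>i<n. \<Sum>j<n. if cross i j then F (move j i w0) * (F (move i j w0) - F w0) else 0) =
      (\<Sum>i<n. \<Sum>j<n. (F w0)\<^sup>2 -
         (if cross i j then (F (move j i w0) - F w0) * (F (move i j w0) - F w0) else 0))"
    unfolding sum_subtractf[symmetric]
    by (intro sum.cong refl) (auto simp: same power2_eq_square algebra_simps)
  also have "\<dots> = (real n)\<^sup>2 * (F w0)\<^sup>2 -
      (\<Sum>i<n. \<Sum>j<n. if cross i j then (F (move j i w0) - F w0) * (F (move i j w0) - F w0) else 0)"
    by (simp add: sum_subtractf power2_eq_square)
  also have "(\<Sum>i<n. \<Sum>j<n. if cross i j then (F (move j i w0) - F w0) * (F (move i j w0) - F w0) else 0) =
      2 * (\<Sum>i<k. \<Sum>j\<in>{k..<n}. (F (move k i w0) - F w0) * (F (move 0 j w0) - F w0))"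
  proof -
    define h where "h i j = (F (move j i w0) - F w0) * (F (move i j w0) - F w0)" for i j
    have split: "(\<Sum>i<n. g i) = (\<Sum>i<k. g i) + (\<Sum>i\<in>{k..<n}. g i)" for g :: "nat \<Rightarrow> real"
      using sum.atLeastLessThan_concat[of 0 k n g] by (simp add: n_def atLeast0LessThan)
    have h: "h i j = (F (move k i w0) - F w0) * (F (move 0 j w0) - F w0)" if "i < k" "k \<le> j" "j < n" for i j
    proof -
      have "move j i w0 = move k i w0" "move i j w0 = move 0 j w0"
        unfolding w0_def by (rule move_sorted_word_cong; use that assms(3,4) in \<open>auto simp: n_def\<close>)+
      then show ?thesis by (simp add: h_def)
    qed
    have "(\<Sum>i<n. \<Sum>j<n. if cross i j then h i j else 0) =
        (\<Sum>i<k. \<Sum>j\<in>{k..<n}. h i j) + (\<Sum>i\<in>{k..<n}. \<Sum>j<k. h i j)"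
      unfolding split by (simp add: cross_def sum.distrib not_le)
    also have "(\<Sum>i\<in>{k..<n}. \<Sum>j<k. h i j) = (\<Sum>i<k. \<Sum>j\<in>{k..<n}. h i j)"
      by (subst sum.swap) (simp add: h_def mult.commute)
    finally have "(\<Sum>i<n. \<Sum>j<n. if cross i j then h i j else 0) =
        2 * (\<Sum>i<k. \<Sum>j\<in>{k..<n}. h i j)" by simp
    also have "(\<Sum>i<k. \<Sum>j\<in>{k..<n}. h i j) =
        (\<Sum>i<k. \<Sum>j\<in>{k..<n}. (F (move k i w0) - F w0) * (F (move 0 j w0) - F w0))"
      by (intro sum.cong refl h) auto
    finally show ?thesis by (simp only: h_def)
  qed
  also have "(\<Sum>i<k. \<Sum>j\<in>{k..<n}. (F (move k i w0) - F w0) * (F (move 0 j w0) - F w0)) =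
      (\<Sum>i<k. F (move k i w0) - F w0) * (\<Sum>j\<in>{k..<n}. F (move 0 j w0) - F w0)"
    by (simp add: sum_product)
  also have "(\<Sum>i<k. F (move k i w0) - F w0) = 0"
    using mean by (simp add: sum_subtractf)
  finally show ?thesis using B0 B1 by simp
qed

text \<open>
  With \<open>q\<close> the square norm of \<open>f\<close>, \<open>c\<close> the mean value put at \<open>w\<^sub>0\<close> and \<open>N\<close> the number of words, the
  extension \<open>F\<close> has sum \<open>c\<close> and square norm \<open>q + c\<^sup>2\<close>. The quadratic form bound for \<open>F - c / N\<close> then
  reads \<open>\<mu> q \<le> \<beta> q - (n\<^sup>2 - \<beta>) (c\<^sup>2 - c\<^sup>2 / N)\<close>, and the subtracted term is nonnegative.
\<close>

lemma avoiding_eigenvalue_bound: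
  fixes f :: "bool list \<Rightarrow> real" and k l :: nat
  defines "w0 \<equiv> sorted_word k l" and "n \<equiv> k + l"
  assumes "k \<ge> 1" "l \<ge> 1"
    and eig: "\<And>w. w \<in> binary_words k l - {w0} \<Longrightarrow> (\<Sum>i<n. \<Sum>j<n. f (run (avoid_swap w0) i j w)) = \<mu> * f w"
    and run: "\<And>w i j. w \<in> binary_words k l - {w0} \<Longrightarrow> i < n \<Longrightarrow> j < n \<Longrightarrow>
       run (avoid_swap w0) i j w \<in> binary_words k l - {w0}"
    and f0: "(\<Sum>w\<in>binary_words k l - {w0}. f w) = 0" and fn: "\<exists>w\<in>binary_words k l - {w0}. f w \<noteq> 0"
  shows "\<mu> \<le> (real n + 1) * (real n - 2)"
proof -
  let ?W = "binary_words k l" and ?W' = "binary_words k l - {w0}"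
  define c where "c = (\<Sum>i<k. f (move k i w0)) / real k"
  define F where "F = f(w0 := c)"
  define N where "N = real (card ?W)"
  define \<beta> where "\<beta> = (real n + 1) * (real n - 2)"
  have w0: "w0 \<in> ?W" by (simp add: w0_def)
  have N: "N \<ge> 2" using binary_words_card_ge2[OF assms(3,4)] by (simp add: N_def)
  have Ff: "F w = f w" if "w \<noteq> w0" for w using that by (simp add: F_def)
  have Fc: "F w0 = c" by (simp add: F_def)
  have split: "(\<Sum>w\<in>?W. g w) = g w0 + (\<Sum>w\<in>?W'. g w)" for g :: "bool list \<Rightarrow> real"
    using w0 by (intro sum.remove) auto
  have "(\<Sum>i<k. F (move k i w0)) = (\<Sum>i<k. f (move k i w0))"
  proof (intro sum.cong refl Ff)
    fix i assume "i \<in> {..<k}"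
    then show "move k i w0 \<noteq> w0"
      unfolding w0_def by (intro move_sorted_word_neq) (use assms(4) in auto)
  qed
  then have mean: "(\<Sum>i<k. F (move k i (sorted_word k l))) = real k * F (sorted_word k l)"
    using assms(3) Fc by (simp add: c_def w0_def)
  have sF: "(\<Sum>w\<in>?W. F w) = c"
    unfolding split Fc using f0 by (simp add: Ff)
  define q where "q = (\<Sum>w\<in>?W'. (f w)\<^sup>2)"
  have sF2: "(\<Sum>w\<in>?W. (F w)\<^sup>2) = q + c\<^sup>2"
    unfolding split Fc by (simp add: Ff q_def)
  have B0: "(\<Sum>w\<in>?W. F w * shuffle_op F w) = \<mu> * q + (real n)\<^sup>2 * c\<^sup>2"
  proof -
    have "(\<Sum>w\<in>?W'. F w * (\<Sum>i<n. \<Sum>j<n. F (run (avoid_swap w0) i j w))) = (\<Sum>w\<in>?W'. \<mu> * (f w)\<^sup>2)"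
    proof (intro sum.cong refl)
      fix w assume w: "w \<in> ?W'"
      have "(\<Sum>i<n. \<Sum>j<n. F (run (avoid_swap w0) i j w)) = (\<Sum>i<n. \<Sum>j<n. f (run (avoid_swap w0) i j w))"
        using run[OF w] by (intro sum.cong refl Ff) auto
      then show "F w * (\<Sum>i<n. \<Sum>j<n. F (run (avoid_swap w0) i j w)) = \<mu> * (f w)\<^sup>2"
        using eig[OF w] w Ff[of w] by (simp add: power2_eq_square)
    qed
    then show ?thesis
      using comparison_identity[OF assms(3,4) mean] Fc
      by (simp add: w0_def[symmetric] n_def[symmetric] q_def sum_distrib_left)
  qed
  define m where "m = c / N"
  have mN: "m * N = c" using N by (simp add: m_def)
  have mean_zero: "(\<Sum>w\<in>?W. F w - m) = 0"
    using sF mN by (simp add: sum_subtractf N_def mult.commute)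
  have shift: "shuffle_op (\<lambda>w. F w - m) w = shuffle_op F w - (real n)\<^sup>2 * m" if "w \<in> ?W" for w
    using length_binary_words[OF that] by (simp add: shuffle_op_sum sum_subtractf n_def power2_eq_square)
  have "(\<Sum>w\<in>?W. (F w - m) * shuffle_op (\<lambda>w. F w - m) w) =
      (\<Sum>w\<in>?W. F w * shuffle_op F w - m * shuffle_op F w - (real n)\<^sup>2 * m * (F w - m))"
    by (intro sum.cong refl) (simp add: shift algebra_simps)
  also have "\<dots> = \<mu> * q + (real n)\<^sup>2 * c\<^sup>2 - (real n)\<^sup>2 * (m * c)"
    using mean_zero sum_shuffle_op[of F k l] sF B0
    by (simp add: sum_subtractf n_def[symmetric] flip: sum_distrib_left)
  finally have lhs: "(\<Sum>w\<in>?W. (F w - m) * shuffle_op (\<lambda>w. F w - m) w) = \<dots>" .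
  have "(\<Sum>w\<in>?W. (F w - m)\<^sup>2) = (\<Sum>w\<in>?W. (F w)\<^sup>2 - m * F w - m * (F w - m))"
    by (intro sum.cong refl) (simp add: power2_eq_square algebra_simps)
  also have "\<dots> = q + c\<^sup>2 - m * c"
    using mean_zero sF sF2 by (simp add: sum_subtractf flip: sum_distrib_left)
  finally have rhs: "(\<Sum>w\<in>?W. (F w - m)\<^sup>2) = q + c\<^sup>2 - m * c" .
  have "\<mu> * q + (real n)\<^sup>2 * c\<^sup>2 - (real n)\<^sup>2 * (m * c) \<le> \<beta> * (q + c\<^sup>2 - m * c)"
    using two_chain_rayleigh_bound[OF assms(3,4) mean_zero] unfolding lhs rhs
    by (simp add: \<beta>_def n_def)
  then have "\<mu> * q \<le> \<beta> * q - ((real n)\<^sup>2 - \<beta>) * (c\<^sup>2 - m * c)"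
    by (simp add: algebra_simps)
  moreover have "0 \<le> ((real n)\<^sup>2 - \<beta>) * (c\<^sup>2 - m * c)"
  proof (rule mult_nonneg_nonneg)
    show "0 \<le> (real n)\<^sup>2 - \<beta>"
      by (simp add: \<beta>_def power2_eq_square algebra_simps)
    have "m * c = c\<^sup>2 / N" by (simp add: m_def power2_eq_square)
    also have "\<dots> \<le> c\<^sup>2 / 1"
      by (rule divide_left_mono) (use N in auto)
    finally show "0 \<le> c\<^sup>2 - m * c" by simp
  qed
  ultimately have "\<mu> * q \<le> \<beta> * q" by linarith
  moreover have "q > 0"
  proof -
    obtain w where "w \<in> ?W'" "f w \<noteq> 0" using fn by blast
    then show ?thesis
      unfolding q_def by (intro sum_pos2[of _ w]) auto
  qed
  ultimately show ?thesis by (simp add: \<beta>_def)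
qed

section \<open>Linear extensions as words\<close>

lemma finite_linear_extensions [simp]: "finite (linear_extensions n r)"
  by (rule finite_subset[OF _ finite_permutations[of "{1..n}"]]) (auto simp: linear_extensions_def)

lemma tau_linear_extension:
  assumes "\<pi> \<in> linear_extensions n r" "1 \<le> i" "i < n"
  shows "tau r i \<pi> \<in> linear_extensions n r"
proof (cases "incomparable r (\<pi> i) (\<pi> (i + 1))")
  case True
  let ?t = "transpose i (i + 1)"
  have perm: "\<pi> permutes {1..n}"
    and ext: "\<And>a b. a \<in> {1..n} \<Longrightarrow> b \<in> {1..n} \<Longrightarrow> (\<pi> a, \<pi> b) \<in> r \<Longrightarrow> \<pi> a \<noteq> \<pi> b \<Longrightarrow> a < b"
    using assms(1) by (auto simp: linear_extensions_def)
  have t: "?t permutes {1..n}"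
    using assms by (intro permutes_swap_id) auto
  have "a < b" if ab: "a \<in> {1..n}" "b \<in> {1..n}" "((\<pi> \<circ> ?t) a, (\<pi> \<circ> ?t) b) \<in> r" "(\<pi> \<circ> ?t) a \<noteq> (\<pi> \<circ> ?t) b" for a b
  proof (rule ccontr)
    assume "\<not> a < b"
    moreover have "a \<noteq> b" using ab(4) by auto
    ultimately have "b < a" by simp
    have "?t a \<in> {1..n}" "?t b \<in> {1..n}"
      using ab permutes_in_image[OF t] by blast+
    then have "?t a < ?t b"
      using ab by (intro ext) auto
    with \<open>b < a\<close> have "b = i" "a = i + 1"
      by (auto simp: transpose_def split: if_splits)
    then have "(\<pi> i, \<pi> (i + 1)) \<in> r" using ab(3) by simp
    with True show False by (simp add: incomparable_def)
  qed
  then have "\<pi> \<circ> ?t \<in> linear_extensions n r"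
    using permutes_compose[OF t perm] by (auto simp: linear_extensions_def)
  with True show ?thesis by (simp add: tau_def)
qed (use assms in \<open>simp add: tau_def\<close>)

lemma tau_involution: "tau r i (tau r i \<pi>) = \<pi>"
  by (auto simp: tau_def incomparable_def o_assoc[symmetric])

lemma fold_tau_rev: "fold (tau r) (rev xs) (fold (tau r) xs \<pi>) = \<pi>"
  by (induction xs arbitrary: \<pi>) (simp_all add: tau_involution)

lemma T_op_inverse: "T_op r j i (T_op r i j \<pi>) = \<pi>"
  using fold_tau_rev[of r "[i..<j]" \<pi>] fold_tau_rev[of r "rev [j..<i]" \<pi>]
  by (auto simp: T_op_def)

lemma fold_tau_linear_extension:
  assumes "\<pi> \<in> linear_extensions n r" "set xs \<subseteq> {1..<n}"
  shows "fold (tau r) xs \<pi> \<in> linear_extensions n r"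
  using assms by (induction xs arbitrary: \<pi>) (simp_all add: tau_linear_extension)

lemma T_op_linear_extension:
  assumes "\<pi> \<in> linear_extensions n r" "i \<in> {1..n}" "j \<in> {1..n}"
  shows "T_op r i j \<pi> \<in> linear_extensions n r"
  unfolding T_op_def using assms by (auto intro!: fold_tau_linear_extension)

lemma r2r_prob_sym: "r2r_prob n r \<pi> \<pi>' = r2r_prob n r \<pi>' \<pi>"
proof -
  have "{(i, j). i \<in> {1..n} \<and> j \<in> {1..n} \<and> \<pi>' = T_op r i j \<pi>} =
      prod.swap ` {(i, j). i \<in> {1..n} \<and> j \<in> {1..n} \<and> \<pi> = T_op r i j \<pi>'}"
    by (force simp: T_op_inverse)
  then show ?thesis
    by (simp add: r2r_prob_def card_image)
qed

lemma r2r_prob_action: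
  assumes "\<pi> \<in> linear_extensions n r"
  shows "(\<Sum>\<pi>'\<in>linear_extensions n r. r2r_prob n r \<pi> \<pi>' * g \<pi>') =
           (\<Sum>i<n. \<Sum>j<n. g (T_op r (Suc i) (Suc j) \<pi>)) / (real n)\<^sup>2"
proof -
  let ?L = "linear_extensions n r"
  have prob: "r2r_prob n r \<pi> \<pi>' = (\<Sum>i<n. \<Sum>j<n. of_bool (\<pi>' = T_op r (Suc i) (Suc j) \<pi>)) / (real n)\<^sup>2" for \<pi>'
  proof -
    let ?D = "({..<n} \<times> {..<n}) \<inter> {(i, j). \<pi>' = T_op r (Suc i) (Suc j) \<pi>}"
    have "{(i, j). i \<in> {1..n} \<and> j \<in> {1..n} \<and> \<pi>' = T_op r i j \<pi>} = map_prod Suc Suc ` ?D"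
    proof (intro equalityI subsetI)
      fix p assume "p \<in> {(i, j). i \<in> {1..n} \<and> j \<in> {1..n} \<and> \<pi>' = T_op r i j \<pi>}"
      then obtain i j where "p = (Suc i, Suc j)" "i < n" "j < n" "\<pi>' = T_op r (Suc i) (Suc j) \<pi>"
        by (cases p; cases "fst p"; cases "snd p") auto
      then show "p \<in> map_prod Suc Suc ` ?D" by force
    qed auto
    then have "card {(i, j). i \<in> {1..n} \<and> j \<in> {1..n} \<and> \<pi>' = T_op r i j \<pi>} = card ?D"
      by (simp add: card_image prod.inj_map inj_on_subset[OF _ subset_UNIV])
    also have "real (card ?D) = (\<Sum>(i, j)\<in>{..<n} \<times> {..<n}. of_bool (\<pi>' = T_op r (Suc i) (Suc j) \<pi>))"
      by (simp add: sum_of_bool_eq case_prod_unfold)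
    finally show ?thesis
      by (simp only: r2r_prob_def sum.cartesian_product)
  qed
  have "(\<Sum>\<pi>'\<in>?L. r2r_prob n r \<pi> \<pi>' * g \<pi>') =
      (\<Sum>\<pi>'\<in>?L. \<Sum>i<n. \<Sum>j<n. of_bool (\<pi>' = T_op r (Suc i) (Suc j) \<pi>) * g \<pi>') / (real n)\<^sup>2"
    by (simp only: prob sum_distrib_right sum_divide_distrib times_divide_eq_left)
  also have "(\<Sum>\<pi>'\<in>?L. \<Sum>i<n. \<Sum>j<n. of_bool (\<pi>' = T_op r (Suc i) (Suc j) \<pi>) * g \<pi>') =
      (\<Sum>i<n. \<Sum>j<n. \<Sum>\<pi>'\<in>?L. of_bool (\<pi>' = T_op r (Suc i) (Suc j) \<pi>) * g \<pi>')"
    by (rule sum_rotate)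
  also have "\<dots> = (\<Sum>i<n. \<Sum>j<n. g (T_op r (Suc i) (Suc j) \<pi>))"
  proof (intro sum.cong refl)
    fix i j assume "i \<in> {..<n}" "j \<in> {..<n}"
    then have "T_op r (Suc i) (Suc j) \<pi> \<in> ?L"
      by (intro T_op_linear_extension[OF assms]) auto
    moreover have "(\<Sum>\<pi>'\<in>?L. of_bool (\<pi>' = T_op r (Suc i) (Suc j) \<pi>) * g \<pi>') =
        (\<Sum>\<pi>'\<in>?L. if \<pi>' = T_op r (Suc i) (Suc j) \<pi> then g \<pi>' else 0)"
      by (intro sum.cong) auto
    ultimately show "(\<Sum>\<pi>'\<in>?L. of_bool (\<pi>' = T_op r (Suc i) (Suc j) \<pi>) * g \<pi>') = g (T_op r (Suc i) (Suc j) \<pi>)"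
      by simp
  qed
  finally show ?thesis .
qed

lemma trancl_N_shape_gens:
  assumes "(x, y) \<in> (N_shape_gens n k)\<^sup>+"
  shows "x < y \<and> (y \<le> k \<or> k < x) \<or> x = k + 1 \<and> y = k"
  using assms by (induction rule: trancl_induct) (auto simp: N_shape_gens_def)

lemma N_shape_chain:
  assumes "1 \<le> x" "y \<le> n" "x < y" "y \<le> k \<or> k < x"
  shows "(x, y) \<in> (N_shape_gens n k)\<^sup>+"
proof -
  have step: "(a, Suc a) \<in> N_shape_gens n k" if "x \<le> a" "a < y" for a
    using assms that by (auto simp: N_shape_gens_def)
  have "Suc x \<le> y" using assms by simp
  then show ?thesis using step
  proof (induction y rule: dec_induct)
    case base
    then show ?case by auto
  next
    case (step y)
    then have "(x, y) \<in> (N_shape_gens n k)\<^sup>+" "(y, Suc y) \<in> N_shape_gens n k" by auto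
    then show ?case by (rule trancl_into_trancl)
  qed
qed

text \<open>\<open>k + 1\<close> is minimal and \<open>k\<close> is maximal, so the relation between the chains generates no further pairs.\<close>

lemma N_shape_iff:
  assumes "x \<in> {1..n}" "y \<in> {1..n}" "x \<noteq> y"
  shows "(x, y) \<in> N_shape n k \<longleftrightarrow> x < y \<and> (y \<le> k \<or> k < x) \<or> x = k + 1 \<and> y = k"
proof -
  have "(k + 1, k) \<in> (N_shape_gens n k)\<^sup>+"
    by (auto simp: N_shape_gens_def)
  then show ?thesis
    using assms trancl_N_shape_gens[of x y n k] N_shape_chain[of x y n k]
    by (auto simp: N_shape_def)
qed

lemma sorted_word_unique:
  assumes "xs @ ys \<in> binary_words k l" "True \<notin> set xs" "False \<notin> set ys"
  shows "xs @ ys = sorted_word k l"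
proof -
  have xs: "xs = replicate (length xs) False" and ys: "ys = replicate (length ys) True"
    using assms(2,3) by (metis (full_types) replicate_eqI)+
  have "mset (replicate (length xs) False @ replicate (length ys) True) = replicate_mset k False + replicate_mset l True"
    using assms(1) xs ys by (simp add: binary_words_def)
  then have "count (mset (replicate (length xs) False @ replicate (length ys) True)) c =
      count (replicate_mset k False + replicate_mset l True) c" for c by simp
  from this[of False] this[of True] have "length xs = k" "length ys = l" by auto
  with xs ys show ?thesis by simp
qed

definition chain_word :: "nat \<Rightarrow> nat \<Rightarrow> (nat \<Rightarrow> nat) \<Rightarrow> bool list" where
  "chain_word n k \<pi> = map (\<lambda>i. k < \<pi> i) [1..<Suc n]"

lemma length_chain_word [simp]: "length (chain_word n k \<pi>) = n"
  by (simp add: chain_word_def)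

lemma nth_chain_word [simp]: "p < n \<Longrightarrow> chain_word n k \<pi> ! p \<longleftrightarrow> k < \<pi> (Suc p)"
  by (simp add: chain_word_def del: upt_Suc)

lemma chain_word_swap:
  assumes "Suc p < n"
  shows "chain_word n k (\<pi> \<circ> transpose (Suc p) (Suc (Suc p))) = swap_adj p (chain_word n k \<pi>)"
proof (rule nth_equalityI)
  fix q assume "q < length (chain_word n k (\<pi> \<circ> transpose (Suc p) (Suc (Suc p))))"
  then show "chain_word n k (\<pi> \<circ> transpose (Suc p) (Suc (Suc p))) ! q = swap_adj p (chain_word n k \<pi>) ! q"
    using assms by (auto simp: swap_adj_def nth_list_update transpose_def)
qed simp

context
  fixes n k :: nat
  assumes k1: "1 \<le> k" and kn: "k < n"
begin

abbreviation "LE \<equiv> linear_extensions n (N_shape n k)"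
abbreviation "w0 \<equiv> sorted_word k (n - k)"
abbreviation "W \<equiv> binary_words k (n - k)"

lemma
  assumes "\<pi> \<in> LE"
  shows LE_permutes: "\<pi> permutes {1..n}"
    and LE_in: "i \<in> {1..n} \<Longrightarrow> \<pi> i \<in> {1..n}"
    and LE_chain: "i \<in> {1..n} \<Longrightarrow> j \<in> {1..n} \<Longrightarrow> \<pi> i < \<pi> j \<Longrightarrow> \<pi> j \<le> k \<or> k < \<pi> i \<Longrightarrow> i < j"
    and LE_cross: "i \<in> {1..n} \<Longrightarrow> j \<in> {1..n} \<Longrightarrow> \<pi> i = k + 1 \<Longrightarrow> \<pi> j = k \<Longrightarrow> i < j"
proof -
  show perm: "\<pi> permutes {1..n}" using assms by (simp add: linear_extensions_def)
  show im: "i \<in> {1..n} \<Longrightarrow> \<pi> i \<in> {1..n}" for i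
    using permutes_in_image[OF perm] by blast
  have ext: "i < j" if "i \<in> {1..n}" "j \<in> {1..n}" "(\<pi> i, \<pi> j) \<in> N_shape n k" "\<pi> i \<noteq> \<pi> j" for i j
    using assms that by (auto simp: linear_extensions_def)
  show "i \<in> {1..n} \<Longrightarrow> j \<in> {1..n} \<Longrightarrow> \<pi> i < \<pi> j \<Longrightarrow> \<pi> j \<le> k \<or> k < \<pi> i \<Longrightarrow> i < j"
    by (rule ext) (use N_shape_iff[OF im im, of i j k] in auto)
  show "i \<in> {1..n} \<Longrightarrow> j \<in> {1..n} \<Longrightarrow> \<pi> i = k + 1 \<Longrightarrow> \<pi> j = k \<Longrightarrow> i < j"
    by (rule ext) (use N_shape_iff[OF im im, of i j k] in auto)
qed

lemma chain_word_binary_words: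
  assumes "\<pi> permutes {1..n}"
  shows "chain_word n k \<pi> \<in> W"
proof -
  have "mset (map \<pi> [1..<Suc n]) = mset [1..<Suc n]"
  proof -
    have "mset (map \<pi> [1..<Suc n]) = image_mset \<pi> (mset_set {1..<Suc n})"
      by (simp only: mset_map mset_upt)
    also have "\<dots> = mset_set (\<pi> ` {1..<Suc n})"
      using permutes_inj_on[OF assms] by (intro image_mset_mset_set)
    also have "\<pi> ` {1..<Suc n} = {1..<Suc n}"
      using permutes_image[OF assms] by (simp add: atLeastLessThanSuc_atLeastAtMost)
    finally show ?thesis by (simp only: mset_upt)
  qed
  moreover have "mset (chain_word n k \<sigma>) = image_mset (\<lambda>x. k < x) (mset (map \<sigma> [1..<Suc n]))" for \<sigma>
    by (simp add: chain_word_def multiset.map_comp o_def del: upt_Suc)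
  ultimately have "mset (chain_word n k \<pi>) = mset (chain_word n k id)"
    by (simp only: list.map_id)
  also have "chain_word n k id = w0"
    by (rule nth_equalityI) (use kn in \<open>auto simp: nth_append\<close>)
  finally show ?thesis by (simp add: binary_words_def)
qed

lemma chain_word_neq_sorted:
  assumes "\<pi> \<in> LE"
  shows "chain_word n k \<pi> \<noteq> w0"
proof
  assume eq: "chain_word n k \<pi> = w0"
  have "k + 1 \<in> \<pi> ` {1..n}" "k \<in> \<pi> ` {1..n}"
    using permutes_image[OF LE_permutes[OF assms]] k1 kn by auto
  then obtain a b where a: "a \<in> {1..n}" "k + 1 = \<pi> a" and b: "b \<in> {1..n}" "k = \<pi> b"
    by (elim imageE) blast
  have "a < b"
    by (rule LE_cross[OF assms a(1) b(1) a(2)[symmetric] b(2)[symmetric]])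
  moreover have "w0 ! (a - 1)"
    unfolding eq[symmetric] using a by (cases a) auto
  moreover have "\<not> w0 ! (b - 1)"
    unfolding eq[symmetric] using b by (cases b) auto
  ultimately have "a - 1 \<ge> k" "b - 1 < k"
    using b(1) kn by (simp_all add: nth_append split: if_splits)
  with \<open>a < b\<close> show False by linarith
qed

text \<open>
  Two adjacent entries are comparable if they lie in the same chain, and then swapping their letters
  has no effect, or if they are \<open>k + 1\<close> and \<open>k\<close>, and then swapping their letters gives the sorted word.
\<close>

lemma chain_word_tau:
  assumes \<pi>: "\<pi> \<in> LE" and p: "Suc p < n"
  shows "chain_word n k (tau (N_shape n k) (Suc p) \<pi>) = avoid_swap w0 p (chain_word n k \<pi>)"
proof -
  let ?r = "N_shape n k" and ?w = "chain_word n k \<pi>"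
  let ?x = "\<pi> (Suc p)" and ?y = "\<pi> (Suc (Suc p))"
  have xy: "?x \<in> {1..n}" "?y \<in> {1..n}" using LE_in[OF \<pi>] p by auto
  have neq: "?x \<noteq> ?y" using permutes_inj[OF LE_permutes[OF \<pi>]] by (simp add: inj_eq)
  show ?thesis
  proof (cases "incomparable ?r ?x ?y")
    case True
    then have tau: "tau ?r (Suc p) \<pi> = \<pi> \<circ> transpose (Suc p) (Suc (Suc p))"
      by (simp add: tau_def)
    have "tau ?r (Suc p) \<pi> \<in> LE"
      using \<pi> p by (intro tau_linear_extension) auto
    then have "chain_word n k (tau ?r (Suc p) \<pi>) \<noteq> w0" by (rule chain_word_neq_sorted)
    then show ?thesis using p by (simp add: tau chain_word_swap avoid_swap_def)
  next
    case False
    then have tau: "tau ?r (Suc p) \<pi> = \<pi>" by (simp add: tau_def)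
    from False have "(?x, ?y) \<in> ?r \<or> (?y, ?x) \<in> ?r"
      by (simp add: incomparable_def)
    then have "(k < ?x \<longleftrightarrow> k < ?y) \<or> ?x = k + 1 \<and> ?y = k \<or> ?x = k \<and> ?y = k + 1"
      unfolding N_shape_iff[OF xy neq] N_shape_iff[OF xy(2,1) neq[symmetric]] by auto
    moreover have "\<not> (?x = k \<and> ?y = k + 1)"
      using LE_cross[OF \<pi>, of "Suc (Suc p)" "Suc p"] p by auto
    ultimately consider (same) "k < ?x \<longleftrightarrow> k < ?y" | (cross) "?x = k + 1" "?y = k" by blast
    then show ?thesis
    proof cases
      case same
      then have "swap_adj p ?w = ?w"
        using p by (intro nth_equalityI) (auto simp: swap_adj_def nth_list_update)
      then show ?thesis by (simp add: tau avoid_swap_def)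
    next
      case cross
      \<comment> \<open>everything before these two positions lies in the first chain, everything after in the second\<close>
      have nth: "swap_adj p ?w ! q \<longleftrightarrow> Suc p \<le> q" if "q < n" for q
      proof (cases "q = p \<or> q = Suc p")
        case True
        then show ?thesis using cross p by (auto simp: swap_adj_def nth_list_update)
      next
        case False
        then have "swap_adj p ?w ! q \<longleftrightarrow> k < \<pi> (Suc q)"
          using that p by (auto simp: swap_adj_def nth_list_update)
        moreover have "\<not> k < \<pi> (Suc q)" if "q < p"
        proof
          assume "k < \<pi> (Suc q)"
          moreover have "\<pi> (Suc q) \<noteq> \<pi> (Suc p)"
            using permutes_inj[OF LE_permutes[OF \<pi>]] that by (simp add: inj_eq)
          ultimately have "Suc p < Suc q"
            by - (rule LE_chain[OF \<pi>], use p that cross in \<open>auto\<close>)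
          with that show False by simp
        qed
        moreover have "k < \<pi> (Suc q)" if "q > Suc p"
        proof (rule ccontr)
          assume "\<not> k < \<pi> (Suc q)"
          moreover have "\<pi> (Suc q) \<noteq> \<pi> (Suc (Suc p))"
            using permutes_inj[OF LE_permutes[OF \<pi>]] that by (simp add: inj_eq)
          ultimately have "Suc q < Suc (Suc p)"
            by - (rule LE_chain[OF \<pi>], use p \<open>q < n\<close> cross in \<open>auto\<close>)
          with that show False by simp
        qed
        moreover have "q < p \<or> q > Suc p" using False by linarith
        ultimately show ?thesis by (cases "q < p") simp_all
      qed
      have "swap_adj p ?w \<in> W"
        using chain_word_binary_words[of "\<pi> \<circ> transpose (Suc p) (Suc (Suc p))"] p
          permutes_compose[OF permutes_swap_id LE_permutes[OF \<pi>], of "Suc p" "Suc (Suc p)"]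
        by (simp add: chain_word_swap)
      then have "take (Suc p) (swap_adj p ?w) @ drop (Suc p) (swap_adj p ?w) = w0"
        using nth p by (intro sorted_word_unique) (auto simp: in_set_conv_nth)
      then show ?thesis by (simp add: tau avoid_swap_def)
    qed
  qed
qed

lemma chain_word_T_op:
  assumes "\<pi> \<in> LE" "p < n" "q < n"
  shows "chain_word n k (T_op (N_shape n k) (Suc p) (Suc q) \<pi>) = run (avoid_swap w0) p q (chain_word n k \<pi>)"
proof -
  have fold: "chain_word n k (fold (tau (N_shape n k)) (map Suc xs) \<pi>) = fold (avoid_swap w0) xs (chain_word n k \<pi>)"
    if "set xs \<subseteq> {p. Suc p < n}" for xs
    using that assms(1)
  proof (induction xs arbitrary: \<pi>)
    case (Cons x xs)
    then show ?case
      using chain_word_tau[of \<pi> x] tau_linear_extension[of \<pi> n "N_shape n k" "Suc x"] by simp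
  qed simp
  have up: "[Suc p..<Suc q] = map Suc [p..<q]"
    by (rule map_Suc_upt[symmetric])
  have down: "rev [Suc q..<Suc p] = map Suc (rev [q..<p])"
    by (simp only: rev_map[symmetric] map_Suc_upt)
  show ?thesis
  proof (cases "p \<le> q")
    case True
    have "set [p..<q] \<subseteq> {p. Suc p < n}" using assms(2,3) by auto
    from fold[OF this] True show ?thesis by (simp add: T_op_def run_def up del: upt_Suc)
  next
    case False
    have "set (rev [q..<p]) \<subseteq> {p. Suc p < n}" using assms(2,3) by auto
    from fold[OF this] False show ?thesis by (simp add: T_op_def run_def down del: upt_Suc)
  qed
qed

text \<open>
  The inverse of \<open>chain_word\<close>: number the occurrences of each letter from left to right, along the
  chain of this letter.
\<close>

definition perm_of_word :: "bool list \<Rightarrow> nat \<Rightarrow> nat" where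
  "perm_of_word w i =
     (if i \<in> {1..n} then (if w ! (i - 1) then k else 0) + count_list (take i w) (w ! (i - 1)) else i)"

lemma count_take_chain_word:
  assumes "i \<le> n"
  shows "count_list (take i (chain_word n k \<pi>)) c = card {x \<in> {1..i}. (k < \<pi> x) = c}"
proof -
  have "take i (chain_word n k \<pi>) = map (\<lambda>i. k < \<pi> i) [1..<Suc i]"
    using assms by (simp add: chain_word_def take_map del: upt_Suc)
  then have "count_list (take i (chain_word n k \<pi>)) c = length (filter (\<lambda>x. c = (k < \<pi> x)) [1..<Suc i])"
    by (simp add: count_list_eq_length_filter filter_map o_def del: upt_Suc)
  also have "\<dots> = card (set (filter (\<lambda>x. c = (k < \<pi> x)) [1..<Suc i]))"
    by (rule distinct_card[symmetric]) (intro distinct_filter distinct_upt)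
  also have "set (filter (\<lambda>x. c = (k < \<pi> x)) [1..<Suc i]) = {x \<in> {1..i}. (k < \<pi> x) = c}"
    by auto
  finally show ?thesis .
qed

text \<open>
  In a linear extension the entries of a chain occur in increasing order, so the entries of the chain
  of \<open>\<pi> i\<close> at positions up to \<open>i\<close> are exactly those that do not exceed \<open>\<pi> i\<close>.
\<close>

lemma perm_of_chain_word:
  assumes \<pi>: "\<pi> \<in> LE"
  shows "perm_of_word (chain_word n k \<pi>) = \<pi>"
proof
  fix i
  have inj: "inj \<pi>" using permutes_inj[OF LE_permutes[OF \<pi>]] .
  show "perm_of_word (chain_word n k \<pi>) i = \<pi> i"
  proof (cases "i \<in> {1..n}")
    case False
    then show ?thesis
      using permutes_not_in[OF LE_permutes[OF \<pi>] False] by (simp add: perm_of_word_def del: atLeastAtMost_iff)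
  next
    case i: True
    have pre: "\<exists>x\<in>{1..n}. y = \<pi> x" if "y \<in> {1..n}" for y
      using permutes_image[OF LE_permutes[OF \<pi>]] that by blast
    have *: "\<pi> ` {x \<in> {1..i}. (k < \<pi> x) = c} = {(if c then k + 1 else 1)..\<pi> i}"
      if c: "(k < \<pi> i) = c" for c
    proof (intro equalityI subsetI)
      fix y assume "y \<in> \<pi> ` {x \<in> {1..i}. (k < \<pi> x) = c}"
      then obtain x where x: "x \<in> {1..i}" "(k < \<pi> x) = c" "y = \<pi> x" by blast
      have "\<not> \<pi> i < \<pi> x"
        using LE_chain[OF \<pi> i, of x] x c i by auto
      then show "y \<in> {(if c then k + 1 else 1)..\<pi> i}"
        using LE_in[OF \<pi>, of x] x i by auto
    next
      fix y assume y: "y \<in> {(if c then k + 1 else 1)..\<pi> i}"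
      then have "y \<in> {1..n}" using LE_in[OF \<pi> i] by (auto split: if_splits)
      then obtain x where x: "x \<in> {1..n}" "y = \<pi> x" using pre by blast
      have "x \<le> i"
      proof (cases "y = \<pi> i")
        case True
        then show ?thesis using x inj by (simp add: inj_eq)
      next
        case False
        then have "x < i"
          by - (rule LE_chain[OF \<pi>], use x y c i in \<open>auto split: if_splits\<close>)
        then show ?thesis by simp
      qed
      then show "y \<in> \<pi> ` {x \<in> {1..i}. (k < \<pi> x) = c}"
        using x y c by (auto split: if_splits)
    qed
    have "card {x \<in> {1..i}. (k < \<pi> x) = c} = card (\<pi> ` {x \<in> {1..i}. (k < \<pi> x) = c})" for c
      using inj by (intro card_image[symmetric]) (auto intro: inj_on_subset)
    then have "card {x \<in> {1..i}. (k < \<pi> x) = (k < \<pi> i)} = card {(if k < \<pi> i then k + 1 else 1)..\<pi> i}"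
      by (simp only: *[OF refl])
    also have "\<dots> = (if k < \<pi> i then \<pi> i - k else \<pi> i)"
      by simp
    finally have "card {x \<in> {1..i}. (k < \<pi> x) = (k < \<pi> i)} = \<dots>" .
    then show ?thesis
      using i by (auto simp: perm_of_word_def count_take_chain_word)
  qed
qed

lemma count_take_less:
  assumes "i < j" "j \<le> length w"
  shows "count_list (take i w) (w ! (j - 1)) < count_list (take j w) (w ! (j - 1))"
proof -
  obtain j' where j: "j = Suc j'" using assms by (cases j) auto
  then have "take j w = take i w @ drop i (take j' w) @ [w ! j']"
    using assms by (metis Suc_le_lessD append.assoc append_take_drop_id less_Suc_eq_le min.absorb4 min.absorb1 take_Suc_conv_app_nth take_take)
  then show ?thesis using j by simp
qed

lemma
  assumes w: "w \<in> W - {w0}"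
  shows perm_of_word_LE: "perm_of_word w \<in> LE"
    and chain_word_perm: "chain_word n k (perm_of_word w) = w"
proof -
  have len: "length w = n" using length_binary_words[of w k "n - k"] w kn by simp
  have cnt: "count_list w False = k" "count_list w True = n - k"
    using w by (simp_all add: binary_words_def flip: count_mset)
  let ?\<pi> = "perm_of_word w"
  have \<pi>: "?\<pi> i = (if w ! (i - 1) then k else 0) + count_list (take i w) (w ! (i - 1))" if "i \<in> {1..n}" for i
    using that by (simp add: perm_of_word_def)
  have le: "count_list (take i w) c \<le> count_list w c" for i c
    using count_list_append[of "take i w" "drop i w" c] by simp
  have ge: "count_list (take i w) (w ! (i - 1)) \<ge> 1" if "i \<in> {1..n}" for i
    using count_take_less[of 0 i w] that len by simp
  have range: "?\<pi> i \<in> {1..n}" and letter: "k < ?\<pi> i \<longleftrightarrow> w ! (i - 1)" if "i \<in> {1..n}" for i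
    using le[of i "w ! (i - 1)"] ge[OF that] cnt kn \<pi>[OF that] by (cases "w ! (i - 1)"; simp)+
  show word: "chain_word n k ?\<pi> = w"
    by (rule nth_equalityI) (use len letter in auto)
  have mono: "?\<pi> i < ?\<pi> j" if "i < j" "i \<in> {1..n}" "j \<in> {1..n}" "w ! (i - 1) = w ! (j - 1)" for i j
    using count_take_less[of i j w] that len \<pi> by simp
  have inj: "inj_on ?\<pi> {1..n}"
  proof (rule inj_onI)
    fix i j assume ij: "i \<in> {1..n}" "j \<in> {1..n}" "?\<pi> i = ?\<pi> j"
    then have "w ! (i - 1) = w ! (j - 1)" using letter by metis
    then show "i = j" using mono[of i j] mono[of j i] ij by (metis less_irrefl nat_neq_iff)
  qed
  have "?\<pi> ` {1..n} = {1..n}"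
    using inj range by (intro endo_inj_surj) auto
  then have perm: "?\<pi> permutes {1..n}"
    using inj by (intro bij_imp_permutes) (auto simp: bij_betw_def perm_of_word_def)
  have "i < j" if ij: "i \<in> {1..n}" "j \<in> {1..n}" "(?\<pi> i, ?\<pi> j) \<in> N_shape n k" "?\<pi> i \<noteq> ?\<pi> j" for i j
  proof (rule ccontr)
    assume "\<not> i < j"
    with ij(4) have ji: "j < i" by (metis linorder_neqE_nat)
    from ij N_shape_iff[OF range range ij(4)]
    consider "?\<pi> i < ?\<pi> j" "?\<pi> j \<le> k \<or> k < ?\<pi> i" | "?\<pi> i = k + 1" "?\<pi> j = k" by blast
    then show False
    proof cases
      case 1
      then have "w ! (j - 1) = w ! (i - 1)" using letter ij by (metis leD less_trans)
      with mono[OF ji] ij 1 show False by simp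
    next
      case 2
      \<comment> \<open>the last letter of the first chain precedes the first letter of the second one, so that the
        word is sorted\<close>
      have wi: "w ! (i - 1)" using letter[OF ij(1)] 2 by simp
      have wj: "\<not> w ! (j - 1)" using letter[OF ij(2)] 2 by simp
      have "count_list (take i w) True = 1" "count_list (take j w) False = k"
        using \<pi> ij 2 wi wj by auto
      moreover have "count_list (take j w) True < count_list (take i w) True"
        using count_take_less[OF ji, of w] ij len unfolding eqTrueI[OF wi] by simp
      moreover have "count_list (take j w) False + count_list (drop j w) False = k"
        using count_list_append[of "take j w" "drop j w" False] cnt by simp
      ultimately have "True \<notin> set (take j w)" "False \<notin> set (drop j w)"
        by (auto simp: count_list_0_iff)
      then have "w = w0" using sorted_word_unique[of "take j w" "drop j w" k "n - k"] w by simp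
      with w show False by simp
    qed
  qed
  with perm show "?\<pi> \<in> LE" by (auto simp: linear_extensions_def)
qed

lemma bij_betw_chain_word: "bij_betw (chain_word n k) LE (W - {w0})"
proof (rule bij_betw_byWitness[of _ perm_of_word])
  show "\<forall>\<pi>\<in>LE. perm_of_word (chain_word n k \<pi>) = \<pi>"
    using perm_of_chain_word by blast
  show "\<forall>w\<in>W - {w0}. chain_word n k (perm_of_word w) = w"
    using chain_word_perm by blast
  show "chain_word n k ` LE \<subseteq> W - {w0}"
    using chain_word_binary_words[OF LE_permutes] chain_word_neq_sorted by auto
  show "perm_of_word ` (W - {w0}) \<subseteq> LE"
    using perm_of_word_LE by auto
qed

lemma card_LE_ge2:
  assumes "n \<ge> 3"
  shows "card LE \<ge> 2"
proof -
  let ?x = "move 0 (n - 1) w0" and ?y = "move (n - 1) 0 w0"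
  have len: "length w0 = n" using kn by simp
  have "?x \<in> W - {w0}" "?y \<in> W - {w0}"
    using move_binary_words[of w0 k "n - k"] move_sorted_word_neq[of 0 k "n - k" "n - 1"]
      move_sorted_word_neq[of "n - 1" k "n - k" 0] k1 kn by auto
  moreover have "?x \<noteq> ?y"
  proof (cases "k \<ge> 2")
    case True
    then have "\<not> ?x ! 0" using kn by (simp add: move_def ins_at_def del_at_def nth_append)
    moreover have "?y ! 0" using nth_move[of "n - 1" w0 0] k1 kn by (simp add: nth_append)
    ultimately show ?thesis by metis
  next
    case False
    then have "k = 1" using k1 by simp
    then have "?y ! (n - 1)" using assms by (simp add: move_def ins_at_def del_at_def nth_append)
    moreover have "\<not> ?x ! (n - 1)" using nth_move[of 0 w0 "n - 1"] k1 kn by (simp add: nth_append)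
    ultimately show ?thesis by metis
  qed
  ultimately have "card {?x, ?y} = 2" "{?x, ?y} \<subseteq> W - {w0}"
    by auto
  then have "2 \<le> card (W - {w0})"
    by (metis card_mono finite_Diff finite_binary_words)
  then show ?thesis using bij_betw_same_card[OF bij_betw_chain_word] by linarith
qed

lemma N_shape_eigenvalue_bound:
  assumes eig: "\<And>\<pi>. \<pi> \<in> LE \<Longrightarrow> (\<Sum>\<pi>'\<in>LE. r2r_prob n (N_shape n k) \<pi> \<pi>' * f \<pi>') = \<mu> * f \<pi>"
    and f0: "(\<Sum>\<pi>\<in>LE. f \<pi>) = 0" and fn: "\<exists>\<pi>\<in>LE. f \<pi> \<noteq> 0"
  shows "\<mu> * (real n)\<^sup>2 \<le> (real n + 1) * (real n - 2)"
proof -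
  define g where "g w = f (perm_of_word w)" for w
  have gf: "g (chain_word n k \<pi>) = f \<pi>" if "\<pi> \<in> LE" for \<pi>
    using that by (simp add: g_def perm_of_chain_word)
  have kl: "k + (n - k) = n" using kn by simp
  have T: "T_op (N_shape n k) (Suc i) (Suc j) \<pi> \<in> LE" if "\<pi> \<in> LE" "i < n" "j < n" for \<pi> i j
    using that by (intro T_op_linear_extension) auto
  have "\<mu> * (real n)\<^sup>2 \<le> (real (k + (n - k)) + 1) * (real (k + (n - k)) - 2)"
  proof (rule avoiding_eigenvalue_bound[of k "n - k" g])
    fix w assume w: "w \<in> W - {w0}"
    define \<pi> where "\<pi> = perm_of_word w"
    have \<pi>: "\<pi> \<in> LE" "w = chain_word n k \<pi>"
      using perm_of_word_LE[OF w] chain_word_perm[OF w] by (simp_all add: \<pi>_def)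
    show "(\<Sum>i<k+(n-k). \<Sum>j<k+(n-k). g (run (avoid_swap w0) i j w)) = \<mu> * (real n)\<^sup>2 * g w"
    proof -
      have "(\<Sum>i<n. \<Sum>j<n. g (run (avoid_swap w0) i j w)) = (\<Sum>i<n. \<Sum>j<n. f (T_op (N_shape n k) (Suc i) (Suc j) \<pi>))"
        by (intro sum.cong refl) (simp add: \<pi> T gf flip: chain_word_T_op)
      also have "\<dots> = \<mu> * f \<pi> * (real n)\<^sup>2"
        using eig[OF \<pi>(1)] r2r_prob_action[OF \<pi>(1), of f] kn by (simp add: field_simps)
      finally show ?thesis using \<pi> by (simp add: kl gf)
    qed
    show "run (avoid_swap w0) i j w \<in> W - {w0}" if "i < k + (n - k)" "j < k + (n - k)" for i j
      using chain_word_T_op[OF \<pi>(1), of i j] T[OF \<pi>(1), of i j] that \<pi>(2) kl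
        bij_betwE[OF bij_betw_chain_word] by metis
  next
    have "(\<Sum>w\<in>W - {w0}. g w) = (\<Sum>\<pi>\<in>LE. g (chain_word n k \<pi>))"
      by (rule sum.reindex_bij_betw[OF bij_betw_chain_word, symmetric])
    then show "(\<Sum>w\<in>W - {w0}. g w) = 0" using f0 gf by simp
    show "\<exists>w\<in>W - {w0}. g w \<noteq> 0"
      using fn gf bij_betwE[OF bij_betw_chain_word] by metis
  qed (use k1 kn in auto)
  then show ?thesis by (simp only: kl)
qed

end

theorem theorem3p3:
  fixes n k :: nat
  assumes "n \<ge> 3" and "1 \<le> k" and "k \<le> n - 1"
  shows "lambda2 n (N_shape n k) \<le> (1 + 1 / real n) * (1 - 2 / real n)"
proof -
  let ?L = "linear_extensions n (N_shape n k)"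
  have kn: "k < n" using assms by linarith
  have b: "(1 + 1 / real n) * (1 - 2 / real n) = (real n + 1) * (real n - 2) / (real n)\<^sup>2"
    using assms(1) by (simp add: field_simps power2_eq_square)
  show ?thesis
    unfolding lambda2_def r2r_matrix_def Let_def
  proof (rule second_eigenvalue_le[where A = "r2r_prob n (N_shape n k)" and S = ?L
        and e = "from_nat_into ?L"])
    show "card ?L \<ge> 2" by (rule card_LE_ge2[OF assms(2) kn assms(1)])
    show "bij_betw (from_nat_into ?L) {..<card ?L} ?L"
      by (rule bij_betw_from_nat_into_finite) simp
    show "r2r_prob n (N_shape n k) \<pi> \<pi>' = r2r_prob n (N_shape n k) \<pi>' \<pi>" for \<pi> \<pi>'
      by (rule r2r_prob_sym)
    show "(\<Sum>\<pi>'\<in>?L. r2r_prob n (N_shape n k) \<pi> \<pi>') = 1" if "\<pi> \<in> ?L" for \<pi>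
      using r2r_prob_action[OF that, of "\<lambda>_. 1"] assms(1) by (simp add: power2_eq_square)
    show "\<mu> \<le> (1 + 1 / real n) * (1 - 2 / real n)"
      if "\<And>\<pi>. \<pi> \<in> ?L \<Longrightarrow> (\<Sum>\<pi>'\<in>?L. r2r_prob n (N_shape n k) \<pi> \<pi>' * f \<pi>') = \<mu> * f \<pi>"
        "(\<Sum>\<pi>\<in>?L. f \<pi>) = 0" "\<exists>\<pi>\<in>?L. f \<pi> \<noteq> 0" for f \<mu>
      unfolding b using N_shape_eigenvalue_bound[OF assms(2) kn that] assms(1) by (simp add: field_simps)
    have "(real n + 1) * (real n - 2) < (real n)\<^sup>2"
      by (simp add: power2_eq_square algebra_simps)
    then show "(1 + 1 / real n) * (1 - 2 / real n) < 1"
      unfolding b using assms(1) by (simp add: field_simps)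
  qed simp
qed

end
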